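(* There exists a constant $\delta>0.1$ such that, almost surely, $$\frac{\#\{u\in[n]:Z_u>0\}}{n^{\delta}}\to\infty\quad\text{as } n\to\infty.$$
   Context: The random friend tree process $(T_n)_{n\ge 2}$ is defined as follows. $T_2$ is a single edge joining vertices labelled $1$ and $2$. For $n\ge 2$, given $T_n$ (and the past of the process), $V_n$ is chosen uniformly at random in $\{1,\dots,n\}$, and then $W_n$ is a uniformly random neighbour of $V_n$ in $T_n$; $T_{n+1}$ is obtained from $T_n$ by adding a new vertex labelled $n+1$ joined by an edge to $W_n$. Thus $T_n$ is a tree with vertex set $[n]=\{1,\dots,n\}$. For $v\in[n]$, $D_n(v)$ is the degree of $v$ in $T_n$, and $Z_v:=\liminf_{n\to\infty} D_n(v)/n$. *)

theory Defs
  imports "HOL-Probability.Probability"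
begin

text \<open>
  A simple graph on natural numbers is given by its set of edges, an edge being a two-element set
  of vertices. The sequence \<open>w\<close> lists the attachment vertices: vertex \<open>n + 1\<close> is joined
  to \<open>w n\<close>, for \<open>n \<ge> 2\<close>. The values of \<open>friend_tree w\<close> below \<open>2\<close> are dummies.
\<close>

fun friend_tree :: "(nat \<Rightarrow> nat) \<Rightarrow> nat \<Rightarrow> nat set set" where
  "friend_tree w 0 = {{1, 2}}"
| "friend_tree w (Suc n) =
     (if n < 2 then {{1, 2}} else insert {Suc n, w n} (friend_tree w n))"

definition neighbours :: "nat set set \<Rightarrow> nat \<Rightarrow> nat set" where
  "neighbours E v = {u. {u, v} \<in> E}"

definition tree_degree :: "(nat \<Rightarrow> nat) \<Rightarrow> nat \<Rightarrow> nat \<Rightarrow> nat" where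
  "tree_degree w n v = card (neighbours (friend_tree w n) v)"

definition liminf_degree :: "(nat \<Rightarrow> nat) \<Rightarrow> nat \<Rightarrow> ereal" where
  "liminf_degree w v = liminf (\<lambda>n. ereal (real (tree_degree w n v) / real n))"

definition history ::
  "'w measure \<Rightarrow> (nat \<Rightarrow> 'w \<Rightarrow> nat) \<Rightarrow> (nat \<Rightarrow> 'w \<Rightarrow> nat) \<Rightarrow>
    (nat \<Rightarrow> nat) \<Rightarrow> (nat \<Rightarrow> nat) \<Rightarrow> nat \<Rightarrow> 'w set" where
  "history M V W v w n = {\<omega> \<in> space M. \<forall>i\<in>{2..<n}. V i \<omega> = v i \<and> W i \<omega> = w i}"

text \<open>
  The past up to time \<open>n\<close> is the countably-valued vector of the \<open>V i\<close>, \<open>W i\<close> with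
  \<open>2 \<le> i < n\<close>, and it determines the tree at time \<open>n\<close>. The conditional laws of \<open>V n\<close> given
  the past, and of \<open>W n\<close> given the past and \<open>V n\<close>, are therefore specified on the atoms
  \<open>history M V W v w n\<close>, on which the tree at time \<open>n\<close> is \<open>friend_tree w n\<close>. The conditional
  probabilities are multiplied out, so that nothing is required on null events. Whenever the
  conditioning event has positive probability, the set passed to \<^const>\<open>pmf_of_set\<close> is finite
  and nonempty.
\<close>

locale random_friend_tree = prob_space M
  for M :: "'w measure" and V W :: "nat \<Rightarrow> 'w \<Rightarrow> nat" +
  assumes measurable_V: "n \<ge> 2 \<Longrightarrow> V n \<in> measurable M (count_space UNIV)"
    and measurable_W: "n \<ge> 2 \<Longrightarrow> W n \<in> measurable M (count_space UNIV)"
    and V_uniform: "n \<ge> 2 \<Longrightarrow>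
      prob {\<omega> \<in> history M V W v w n. V n \<omega> = a}
        = prob (history M V W v w n) * pmf (pmf_of_set {1..n}) a"
    and W_uniform: "n \<ge> 2 \<Longrightarrow>
      prob {\<omega> \<in> history M V W v w n. V n \<omega> = a \<and> W n \<omega> = b}
        = prob {\<omega> \<in> history M V W v w n. V n \<omega> = a}
          * pmf (pmf_of_set (neighbours (friend_tree w n) a)) b"

text \<open>The process exists, so that statements about all random friend trees are not vacuous.\<close>

lemma friend_tree_cong:
  "(\<And>i. 2 \<le> i \<Longrightarrow> i < n \<Longrightarrow> w i = w' i) \<Longrightarrow> friend_tree w n = friend_tree w' n"
  by (induction n) auto

definition friend_kernel :: "nat \<Rightarrow> (nat \<Rightarrow> nat \<times> nat) \<Rightarrow> (nat \<times> nat) pmf" where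
  "friend_kernel n f = bind_pmf (pmf_of_set {1..n}) (\<lambda>v.
     map_pmf (Pair v) (pmf_of_set (neighbours (friend_tree (snd \<circ> f) n) v)))"

lemma fst_friend_kernel: "map_pmf fst (friend_kernel n f) = pmf_of_set {1..n}"
  by (simp add: friend_kernel_def map_bind_pmf pmf.map_comp o_def map_pmf_const bind_return_pmf')

lemma pmf_friend_kernel:
  "pmf (friend_kernel n f) (a, b) =
     pmf (pmf_of_set {1..n}) a * pmf (pmf_of_set (neighbours (friend_tree (snd \<circ> f) n) a)) b"
proof -
  let ?q = "\<lambda>v. pmf_of_set (neighbours (friend_tree (snd \<circ> f) n) v)"
  have "pmf (map_pmf (Pair v) (?q v)) (a, b) = indicator {a} v * pmf (?q a) b" for v
  proof (cases "v = a")
    case True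
    then show ?thesis
      using pmf_map_inj'[of "Pair a" "?q a" b] by (simp add: inj_on_def)
  next
    case False
    then have "(a, b) \<notin> set_pmf (map_pmf (Pair v) (?q v))"
      by auto
    with False show ?thesis
      by (simp add: set_pmf_eq)
  qed
  then have "pmf (friend_kernel n f) (a, b)
      = measure_pmf.expectation (pmf_of_set {1..n}) (\<lambda>v. indicator {a} v * pmf (?q a) b)"
    by (simp only: friend_kernel_def pmf_bind)
  also have "\<dots> = pmf (pmf_of_set {1..n}) a * pmf (?q a) b"
    by (simp add: measure_pmf_single)
  finally show ?thesis .
qed

interpretation friend_IT: Ionescu_Tulcea
  "\<lambda>n f. measure_pmf (friend_kernel n f)" "\<lambda>_. count_space (UNIV :: (nat \<times> nat) set)"
proof
  fix n :: nat
  have *: "PiM {0..<n} (\<lambda>_. count_space (UNIV :: (nat \<times> nat) set))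
      = count_space (PiE {0..<n} (\<lambda>_. UNIV))"
    by (rule count_space_PiM_finite) auto
  show "(\<lambda>f. measure_pmf (friend_kernel n f))
      \<in> PiM {0..<n} (\<lambda>_. count_space UNIV) \<rightarrow>\<^sub>M subprob_algebra (count_space UNIV)"
    unfolding * by (simp add: measure_pmf_in_subprob_space space_subprob_algebra
      prob_space_imp_subprob_space measure_pmf.prob_space_axioms)
qed

lemma prob_space_friend_IT: "prob_space friend_IT.PF.lim"
proof (rule prob_spaceI)
  let ?N = "\<lambda>_::nat. count_space (UNIV :: (nat \<times> nat) set)"
  interpret CI: prob_space "friend_IT.CI {}"
    by (rule friend_IT.PF.prob_space_P) auto
  have "emeasure friend_IT.PF.lim (prod_emb UNIV ?N {} (space (PiM {} ?N)))
      = emeasure (friend_IT.CI {}) (space (PiM {} ?N))"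
    by (rule friend_IT.lim) auto
  moreover have "prod_emb UNIV ?N {} (space (PiM {} ?N)) = space friend_IT.PF.lim"
    by (auto simp: prod_emb_def space_PiM)
  moreover have "space (PiM {} ?N) = space (friend_IT.CI {})"
    by (simp add: friend_IT.PF.space_P)
  ultimately show "emeasure friend_IT.PF.lim (space friend_IT.PF.lim) = 1"
    using CI.emeasure_space_1 by metis
qed

lemma friend_IT_step:
  fixes g :: "nat \<Rightarrow> nat \<times> nat" and n :: nat and B :: "(nat \<times> nat) set"
  defines "L \<equiv> friend_IT.PF.lim"
  defines "H \<equiv> {f. \<forall>i\<in>{2..<n}. f i = g i}"
  shows "measure L {f \<in> H. f n \<in> B} = measure L H * measure_pmf.prob (friend_kernel n g) B"
proof -
  let ?N = "\<lambda>_::nat. count_space (UNIV :: (nat \<times> nat) set)"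
  define X where "X = {f \<in> PiE {0..<n} (\<lambda>_. UNIV). f \<in> H}"
  define Y where "Y = {f \<in> PiE {0..<Suc n} (\<lambda>_. UNIV). f \<in> H \<and> f n \<in> B}"
  define C where "C = friend_IT.C 0 n (\<lambda>_. undefined)"
  have PiM_eq: "PiM {0..<k} ?N = count_space (PiE {0..<k} (\<lambda>_. UNIV))" for k :: nat
    by (rule count_space_PiM_finite) auto
  have und: "(\<lambda>_. undefined) \<in> space (PiM {0..<0::nat} ?N)"
    by (simp add: space_PiM)
  have C: "sets C = sets (PiM {0..<n} ?N)" "space C = space (PiM {0..<n} ?N)"
    unfolding C_def using friend_IT.sets_C[OF und] friend_IT.space_C[OF und] by simp_all
  interpret C: prob_space C
    unfolding C_def using und by (rule friend_IT.prob_space_C)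
  interpret L: prob_space L
    unfolding L_def by (rule prob_space_friend_IT)
  have X: "X \<in> sets (PiM {0..<n} ?N)" and Y: "Y \<in> sets (PiM {0..<Suc n} ?N)"
    unfolding PiM_eq by (auto simp: X_def Y_def)
  have emb: "emeasure L (prod_emb UNIV ?N {0..<k} A) = emeasure (friend_IT.C 0 k (\<lambda>_. undefined)) A"
    if "A \<in> sets (PiM {0..<k} ?N)" for k A
  proof -
    have "A \<subseteq> PiE {0..<k} (\<lambda>i. space (?N i))"
      using sets.sets_into_space[OF that] by (simp only: space_PiM)
    then have "prod_emb {0..<k} ?N {0..<k} A = A"
      by (rule prod_emb_id)
    then show ?thesis
      unfolding L_def using that by (simp add: friend_IT.lim friend_IT.emeasure_CI[of _ k])
  qed
  have H_eq: "H = prod_emb UNIV ?N {0..<n} X"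
    by (auto simp: H_def X_def prod_emb_def)
  have HB_eq: "{f \<in> H. f n \<in> B} = prod_emb UNIV ?N {0..<Suc n} Y"
    by (auto simp: H_def Y_def prod_emb_def)
  have "emeasure L {f \<in> H. f n \<in> B} = emeasure (C \<bind> friend_IT.eP n) Y"
    unfolding HB_eq C_def using emb[OF Y] by simp
  also have "\<dots> = (\<integral>\<^sup>+f. emeasure (friend_IT.eP n f) Y \<partial>C)"
    using Y friend_IT.measurable_eP[of n]
    by (intro emeasure_bind) (auto simp: C C.not_empty measurable_cong_sets[OF C(1) refl])
  also have "\<dots> = (\<integral>\<^sup>+f. emeasure (measure_pmf (friend_kernel n g)) B * indicator X f \<partial>C)"
  proof (rule nn_integral_cong)
    fix f assume "f \<in> space C"
    then have f: "f \<in> space (PiM {0..<n} ?N)"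
      by (simp add: C)
    then have fE: "f \<in> PiE {0..<n} (\<lambda>_. UNIV)"
      by (simp add: space_PiM)
    have upd: "f(n := x) \<in> PiE {0..<Suc n} (\<lambda>_. UNIV)" for x
      using fE by (auto simp: PiE_iff extensional_def)
    have "emeasure (friend_IT.eP n f) Y
        = emeasure (friend_kernel n f) ((\<lambda>x. f(n := x)) -` Y)"
      using friend_IT.emeasure_eP[OF f Y] by simp
    also have "(\<lambda>x. f(n := x)) -` Y = (if f \<in> X then B else {})"
      using fE upd by (auto simp: X_def Y_def H_def)
    also have "emeasure (friend_kernel n f) \<dots>
        = emeasure (measure_pmf (friend_kernel n g)) B * indicator X f"
    proof (cases "f \<in> X")
      case True
      then have "friend_tree (snd \<circ> f) n = friend_tree (snd \<circ> g) n"
        by (intro friend_tree_cong) (auto simp: X_def H_def)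
      then have "friend_kernel n f = friend_kernel n g"
        by (simp add: friend_kernel_def)
      with True show ?thesis by simp
    qed simp
    finally show "emeasure (friend_IT.eP n f) Y
        = emeasure (measure_pmf (friend_kernel n g)) B * indicator X f" .
  qed
  also have "\<dots> = emeasure (measure_pmf (friend_kernel n g)) B * emeasure C X"
    using X by (intro nn_integral_cmult_indicator) (simp add: C)
  also have "emeasure C X = emeasure L H"
    unfolding H_eq C_def using emb[OF X] by simp
  finally show ?thesis
    by (simp add: measure_pmf.emeasure_eq_measure L.emeasure_eq_measure mult.commute
      flip: ennreal_mult)
qed

lemma random_friend_tree_exists:
  "\<exists>(M :: (nat \<Rightarrow> nat \<times> nat) measure) V W. random_friend_tree M V W"
proof -
  define L where "L = friend_IT.PF.lim"
  define V :: "nat \<Rightarrow> (nat \<Rightarrow> nat \<times> nat) \<Rightarrow> nat" where "V = (\<lambda>n f. fst (f n))"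
  define W :: "nat \<Rightarrow> (nat \<Rightarrow> nat \<times> nat) \<Rightarrow> nat" where "W = (\<lambda>n f. snd (f n))"
  have sets_L: "sets L = sets (PiM UNIV (\<lambda>_. count_space UNIV))"
    unfolding L_def by simp
  have space_L: "space L = UNIV"
    using sets_eq_imp_space_eq[OF sets_L] by (simp add: space_PiM)
  have coord: "(\<lambda>f. h (f n)) \<in> measurable L (count_space UNIV)"
    for h :: "nat \<times> nat \<Rightarrow> nat" and n
    unfolding measurable_cong_sets[OF sets_L refl] by measurable
  have step: "measure L {f \<in> history L V W v w n. f n \<in> B}
      = measure L (history L V W v w n)
        * measure_pmf.prob (friend_kernel n (\<lambda>i. (v i, w i))) B" for v w n B
  proof -
    have "history L V W v w n = {f. \<forall>i\<in>{2..<n}. f i = (v i, w i)}"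
      by (auto simp: history_def space_L V_def W_def prod_eq_iff)
    then show ?thesis
      using friend_IT_step[of n "\<lambda>i. (v i, w i)" B] by (simp add: L_def)
  qed
  have V_unif: "measure L {f \<in> history L V W v w n. V n f = a}
      = measure L (history L V W v w n) * pmf (pmf_of_set {1..n}) a" for v w n a
  proof -
    have "measure_pmf.prob (friend_kernel n (\<lambda>i. (v i, w i))) (fst -` {a})
        = pmf (pmf_of_set {1..n}) a"
      by (simp only: fst_friend_kernel[symmetric, of n "\<lambda>i. (v i, w i)"] pmf_map)
    then show ?thesis
      using step[of v w n "fst -` {a}"] by (simp add: V_def)
  qed
  have "random_friend_tree L V W"
  proof (intro random_friend_tree.intro random_friend_tree_axioms.intro)
    show "prob_space L"
      unfolding L_def by (rule prob_space_friend_IT)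
    fix n :: nat and v w a b
    show "V n \<in> measurable L (count_space UNIV)" "W n \<in> measurable L (count_space UNIV)"
      unfolding V_def W_def by (rule coord)+
    show "measure L {f \<in> history L V W v w n. V n f = a}
        = measure L (history L V W v w n) * pmf (pmf_of_set {1..n}) a"
      by (rule V_unif)
    have "{f \<in> history L V W v w n. V n f = a \<and> W n f = b}
        = {f \<in> history L V W v w n. f n \<in> {(a, b)}}"
      by (auto simp: V_def W_def prod_eq_iff)
    then have "measure L {f \<in> history L V W v w n. V n f = a \<and> W n f = b}
        = measure L (history L V W v w n) * pmf (friend_kernel n (\<lambda>i. (v i, w i))) (a, b)"
      by (simp only: step measure_pmf_single)
    then show "measure L {f \<in> history L V W v w n. V n f = a \<and> W n f = b}
        = measure L {f \<in> history L V W v w n. V n f = a}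
          * pmf (pmf_of_set (neighbours (friend_tree w n) a)) b"
      by (simp add: V_unif pmf_friend_kernel o_def)
  qed
  then show ?thesis
    by blast
qed

end

theory Submission
  imports Defs "HOL-Real_Asymp.Real_Asymp"
begin

text \<open>
  Call a vertex \<open>u\<close> a hub if \<open>Z\<^sub>u > 0\<close>. The exponent is \<open>\<delta> = 1 / 5\<close>, and the proof has two halves
  that meet in a counting argument: almost surely every edge contains a hub, and almost surely the
  number of vertices of degree at least \<open>2\<close> exceeds a constant times \<open>n powr (2 / 9)\<close>. A vertex of
  degree at least \<open>2\<close> that is no hub has a child, and this child must then be a hub; hence at least
  half as many hubs as vertices of degree at least \<open>2\<close> exist among \<open>1, \<dots>, n\<close>
  (\<open>card_nonleaves_le_cover\<close>).

  Both halves rest on one probabilistic tool: a nonnegative function of the tree whose expectation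
  after one attachment never exceeds its current value is almost surely bounded along the process
  (\<open>AE_supermartingale_bounded\<close>). It is applied to four functions. Throughout, \<open>D\<close> is the degree
  of a vertex, \<open>L\<close> the number of leaves next to it and \<open>B = D - L\<close>.

  Many vertices of degree at least \<open>2\<close>: let \<open>S\<close> be the sum of \<open>L / D\<close> over all vertices, which is
  \<open>n\<close> times the probability that the next vertex attaches to a leaf. For \<open>n \<ge> 7\<close>, every attachment
  increases \<open>S\<close> by an amount between \<open>0\<close> and \<open>1 / 2\<close>, and by at least \<open>S / (3 n)\<close> on average. So
  \<open>n powr (2 / 9) / S\<close> is a supermartingale (\<open>leaf_weight_inverse_step\<close>), and \<open>S\<close> is a lower bound
  for the number of vertices of degree at least \<open>2\<close>.

  Every edge contains a hub. The sum \<open>s\<close> of the degrees at the two ends of an edge tends to infinity,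
  because \<open>n powr (1 / s)\<close> is a supermartingale for as long as the sum does not move. So the degree of
  one end \<open>u\<close> tends to infinity. At \<open>u\<close>, the number \<open>L\<close> grows by one with probability at least
  \<open>L / n\<close> and shrinks by one with probability only \<open>L / (D n)\<close>. The supermartingale
  \<open>(B + 4) / sqrt D\<close> therefore shows that \<open>B\<close> is at most of order \<open>sqrt D\<close>, so that \<open>L\<close> tends to
  infinity with \<open>D\<close>. Finally \<open>(n - 1) / (L - 3)\<close> is a supermartingale while \<open>L \<ge> 6\<close>, which
  makes \<open>L\<close>, and with it \<open>D\<close>, grow linearly.
\<close>

section \<open>Growth of the tree\<close>

definition attachment_seq :: "nat \<Rightarrow> (nat \<Rightarrow> nat) \<Rightarrow> bool" where
  "attachment_seq n w \<longleftrightarrow> (\<forall>i\<in>{2..<n}. w i \<in> {1..i})"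

abbreviation nbrs :: "(nat \<Rightarrow> nat) \<Rightarrow> nat \<Rightarrow> nat \<Rightarrow> nat set" where
  "nbrs w n v \<equiv> neighbours (friend_tree w n) v"

definition leaf_nbrs :: "(nat \<Rightarrow> nat) \<Rightarrow> nat \<Rightarrow> nat \<Rightarrow> nat set" where
  "leaf_nbrs w n v = {a \<in> nbrs w n v. tree_degree w n a = 1}"

definition leaf_count :: "(nat \<Rightarrow> nat) \<Rightarrow> nat \<Rightarrow> nat \<Rightarrow> nat" where
  "leaf_count w n v = card (leaf_nbrs w n v)"

lemma attachment_seq_Suc:
  "2 \<le> n \<Longrightarrow> attachment_seq (Suc n) w \<longleftrightarrow> attachment_seq n w \<and> w n \<in> {1..n}"
  by (auto simp: attachment_seq_def atLeastLessThanSuc)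

lemma nbrs_sym: "u \<in> nbrs w n v \<longleftrightarrow> v \<in> nbrs w n u"
  by (simp add: neighbours_def insert_commute)

lemma friend_tree_2: "friend_tree w 2 = {{1, 2}}"
  by (simp add: numeral_2_eq_2)

lemma nbrs_2: "nbrs w 2 v = (if v = 1 then {2} else if v = 2 then {1} else {})"
  by (auto simp: neighbours_def friend_tree_2 doubleton_eq_iff)

lemma friend_tree_subset:
  assumes "2 \<le> n" "attachment_seq n w" "e \<in> friend_tree w n"
  shows "e \<subseteq> {1..n} \<and> card e = 2"
  using assms
proof (induction n rule: dec_induct)
  case base
  then show ?case by (auto simp: friend_tree_2)
next
  case (step n)
  then have w: "w n \<in> {1..n}" and a: "attachment_seq n w"
    by (auto simp: attachment_seq_Suc)
  show ?case
  proof (cases "e \<in> friend_tree w n")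
    case True
    then show ?thesis using step.IH[OF a] by auto
  next
    case False
    then have "e = {Suc n, w n}" using step by (auto split: if_splits)
    then show ?thesis using w step(1) by auto
  qed
qed

lemma nbrs_subset:
  assumes "2 \<le> n" "attachment_seq n w"
  shows "nbrs w n v \<subseteq> {1..n} - {v}"
proof
  fix u assume "u \<in> nbrs w n v"
  then have "{u, v} \<in> friend_tree w n" by (simp add: neighbours_def)
  from friend_tree_subset[OF assms this] show "u \<in> {1..n} - {v}"
    by (cases "u = v") auto
qed

lemma finite_nbrs: "2 \<le> n \<Longrightarrow> attachment_seq n w \<Longrightarrow> finite (nbrs w n v)"
  by (rule finite_subset[OF nbrs_subset]) auto

lemma nbrs_outside:
  "2 \<le> n \<Longrightarrow> attachment_seq n w \<Longrightarrow> v \<notin> {1..n} \<Longrightarrow> nbrs w n v = {}"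
  using nbrs_subset[of n w] nbrs_sym[of _ w n v] by (metis Diff_iff equals0I subset_iff)

lemma nbrs_step:
  assumes "2 \<le> n" "attachment_seq n w" "b \<in> {1..n}"
  shows "nbrs (w(n := b)) (Suc n) v =
    (if v = Suc n then {b} else if v = b then insert (Suc n) (nbrs w n v) else nbrs w n v)"
proof -
  have "friend_tree (w(n := b)) n = friend_tree w n"
    by (rule friend_tree_cong) auto
  then have *: "friend_tree (w(n := b)) (Suc n) = insert {Suc n, b} (friend_tree w n)"
    using assms by auto
  have "nbrs w n (Suc n) = {}"
    using assms by (intro nbrs_outside) auto
  moreover have "b \<noteq> Suc n" using assms by auto
  ultimately show ?thesis
    unfolding * by (auto simp: neighbours_def doubleton_eq_iff)
qed

\<comment> \<open>Growth is described through \<open>nbrs_step\<close> and its consequences; unfolding the recursion would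
  expose the dummy case below \<open>2\<close>.\<close>
declare friend_tree.simps(2) [simp del]

lemma degree_step:
  assumes "2 \<le> n" "attachment_seq n w" "b \<in> {1..n}"
  shows "tree_degree (w(n := b)) (Suc n) v =
    (if v = Suc n then 1 else if v = b then Suc (tree_degree w n v) else tree_degree w n v)"
proof -
  have "Suc n \<notin> nbrs w n v" using nbrs_subset[OF assms(1,2), of v] by auto
  then show ?thesis
    unfolding tree_degree_def nbrs_step[OF assms] by (auto simp: finite_nbrs[OF assms(1,2)])
qed

lemma degree_pos:
  assumes "2 \<le> n" "attachment_seq n w" "v \<in> {1..n}"
  shows "1 \<le> tree_degree w n v"
  using assms
proof (induction n arbitrary: v rule: dec_induct)
  case base
  then have "v = 1 \<or> v = 2" by auto
  then show ?case by (auto simp: tree_degree_def nbrs_2)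
next
  case (step n)
  then have w: "w n \<in> {1..n}" and a: "attachment_seq n w"
    by (auto simp: attachment_seq_Suc)
  show ?case
    using degree_step[OF step(1) a w, of v] step.IH[OF a, of v] step.prems(2) by (auto split: if_splits)
qed

text \<open>
  The new vertex is a leaf next to \<open>b\<close>, and \<open>b\<close> is no leaf any more. Nothing else changes; in
  particular a vertex loses a leaf exactly when this leaf is the one attached to.
\<close>
lemma leaf_nbrs_step:
  assumes n: "2 \<le> n" and a: "attachment_seq n w" and b: "b \<in> {1..n}" and v: "v \<in> {1..n}"
  shows "leaf_nbrs (w(n := b)) (Suc n) v =
    (if v = b then insert (Suc n) (leaf_nbrs w n v) else leaf_nbrs w n v - {b})"
  using nbrs_subset[OF n a, of v] degree_pos[OF n a b] v
  by (auto simp: leaf_nbrs_def nbrs_step[OF n a b] degree_step[OF n a b])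

lemma leaf_nbrs_subset: "leaf_nbrs w n v \<subseteq> nbrs w n v"
  by (auto simp: leaf_nbrs_def)

lemma finite_leaf_nbrs: "2 \<le> n \<Longrightarrow> attachment_seq n w \<Longrightarrow> finite (leaf_nbrs w n v)"
  by (rule finite_subset[OF leaf_nbrs_subset finite_nbrs])

lemma leaf_count_step:
  assumes n: "2 \<le> n" and a: "attachment_seq n w" and b: "b \<in> {1..n}" and v: "v \<in> {1..n}"
  shows "leaf_count (w(n := b)) (Suc n) v =
    (if v = b then Suc (leaf_count w n v)
     else if b \<in> leaf_nbrs w n v then leaf_count w n v - 1 else leaf_count w n v)"
proof -
  have "Suc n \<notin> leaf_nbrs w n v"
    using nbrs_subset[OF n a, of v] leaf_nbrs_subset[of w n v] by auto
  then show ?thesis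
    unfolding leaf_count_def leaf_nbrs_step[OF assms]
    by (auto simp: finite_leaf_nbrs[OF n a])
qed

lemma leaf_count_le_degree:
  "2 \<le> n \<Longrightarrow> attachment_seq n w \<Longrightarrow> leaf_count w n v \<le> tree_degree w n v"
  unfolding leaf_count_def tree_degree_def
  by (intro card_mono finite_nbrs leaf_nbrs_subset)

lemma nbrs_leaf:
  assumes "b \<in> leaf_nbrs w n v"
  shows "nbrs w n b = {v}"
proof -
  have "v \<in> nbrs w n b" "card (nbrs w n b) = 1"
    using assms nbrs_sym[of b w n v] by (auto simp: leaf_nbrs_def tree_degree_def)
  then show ?thesis by (metis card_1_singletonE singletonD)
qed

lemma degree_mono_Suc:
  assumes "2 \<le> n" "attachment_seq (Suc n) w"
  shows "tree_degree w n v \<le> tree_degree w (Suc n) v"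
proof (cases "v = Suc n")
  case True
  then show ?thesis using assms nbrs_outside[of n w v]
    by (auto simp: tree_degree_def attachment_seq_Suc)
next
  case False
  then show ?thesis using degree_step[of n w "w n" v] assms by (auto simp: attachment_seq_Suc)
qed

lemma nbrs_mono:
  assumes "m \<le> n" "2 \<le> m"
  shows "nbrs w m v \<subseteq> nbrs w n v"
  using assms by (induction n rule: dec_induct) (auto simp: neighbours_def friend_tree.simps(2))

text \<open>
  Two adjacent leaves would be a whole component, which happens only for the initial edge.
\<close>
lemma leaf_parent_degree:
  assumes "3 \<le> n" "attachment_seq n w" "b \<in> leaf_nbrs w n v"
  shows "2 \<le> tree_degree w n v"
  using assms
proof (induction n arbitrary: v b rule: dec_induct)
  case base
  have a: "attachment_seq 2 w" and w: "w 2 \<in> {1..2}"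
    using base attachment_seq_Suc[of 2 w] by (auto simp: numeral_3_eq_3 numeral_2_eq_2)
  have D: "tree_degree w 3 u = (if u = 3 then 1 else if u = w 2 then 2 else tree_degree w 2 u)" for u
    using degree_step[OF _ a w, of u] w by (auto simp: tree_degree_def nbrs_2)
  have N: "nbrs w 3 u = (if u = 3 then {w 2} else if u = w 2 then insert 3 (nbrs w 2 u) else nbrs w 2 u)" for u
    using nbrs_step[OF _ a w, of u] w by auto
  have w': "w 2 = 1 \<or> w 2 = 2" using w by auto
  have "w 2 \<noteq> 3" using w by auto
  then have D2: "tree_degree w 3 (w 2) = 2" by (simp only: D if_False if_True simp_thms)
  have b: "b \<in> nbrs w 3 v" "tree_degree w 3 b = 1" using base(2) by (auto simp: leaf_nbrs_def)
  have "v = w 2"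
  proof (rule ccontr)
    assume "v \<noteq> w 2"
    then have "b = w 2" using b(1) w' unfolding N nbrs_2 by (auto split: if_splits)
    then show False using b(2) D2 by simp
  qed
  then show ?case using D2 by simp
next
  case (step n)
  then have w: "w n \<in> {1..n}" and a: "attachment_seq n w" and n: "2 \<le> n"
    by (auto simp: attachment_seq_Suc)
  show ?case
  proof (cases "v = Suc n")
    case True
    then have "b = w n" "tree_degree w (Suc n) b = 1"
      using step(5) nbrs_step[OF n a w, of v] by (auto simp: leaf_nbrs_def)
    moreover have "tree_degree w (Suc n) (w n) = Suc (tree_degree w n (w n))"
      using degree_step[OF n a w, of "w n"] w by auto
    ultimately show ?thesis using degree_pos[OF n a w] by auto
  next
    case False
    then have v: "v \<in> {1..n}"
      using nbrs_outside[OF _ step(4), of v] step(5) n by (cases "v \<in> {1..Suc n}") (auto simp: leaf_nbrs_def)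
    show ?thesis
    proof (cases "v = w n")
      case True
      then show ?thesis using degree_step[OF n a w, of v] w degree_pos[OF n a v] by auto
    next
      case F: False
      then have "b \<in> leaf_nbrs w n v" using leaf_nbrs_step[OF n a w v] step(5) by auto
      then show ?thesis using step.IH[OF a] degree_step[OF n a w, of v] False F by auto
    qed
  qed
qed

lemma leaf_count_eq_0_if_leaf:
  assumes "3 \<le> n" "attachment_seq n w" "tree_degree w n v = 1"
  shows "leaf_count w n v = 0"
  using leaf_parent_degree[OF assms(1,2), of _ v] assms(3) by (force simp: leaf_count_def)

text \<open>
  A vertex together with neighbours that are all leaves is a connected component, hence the whole
  tree. The induction replaces connectedness: by the induction hypothesis an attachment elsewhere
  than at \<open>v\<close> would be at a leaf next to \<open>v\<close>, which then stops being a leaf.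
\<close>
lemma only_leaf_nbrs_imp_star:
  assumes "2 \<le> n" "attachment_seq n w" "v \<in> {1..n}" "nbrs w n v = leaf_nbrs w n v"
  shows "insert v (nbrs w n v) = {1..n}"
  using assms
proof (induction n arbitrary: v rule: dec_induct)
  case base
  then have "v = 1 \<or> v = 2" by auto
  then show ?case by (auto simp: nbrs_2)
next
  case (step n)
  then have w: "w n \<in> {1..n}" and a: "attachment_seq n w" and n: "2 \<le> n"
    by (auto simp: attachment_seq_Suc)
  have Nv: "nbrs w (Suc n) v = (if v = Suc n then {w n} else if v = w n then insert (Suc n) (nbrs w n v) else nbrs w n v)"
    using nbrs_step[OF n a w, of v] by simp
  have Dw: "tree_degree w (Suc n) (w n) \<ge> 2"
    using degree_step[OF n a w, of "w n"] w degree_pos[OF n a w] by auto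
  have "v \<noteq> Suc n"
  proof
    assume v: "v = Suc n"
    then have "w n \<in> leaf_nbrs w (Suc n) v" using Nv step(6) by auto
    then show False using Dw by (auto simp: leaf_nbrs_def)
  qed
  then have v: "v \<in> {1..n}" using step(5) by auto
  have Lv: "leaf_nbrs w (Suc n) v = (if v = w n then insert (Suc n) (leaf_nbrs w n v) else leaf_nbrs w n v - {w n})"
    using leaf_nbrs_step[OF n a w v] by simp
  have Sn: "Suc n \<notin> nbrs w n v" "Suc n \<notin> leaf_nbrs w n v"
    using nbrs_subset[OF n a, of v] leaf_nbrs_subset[of w n v] by auto
  show ?case
  proof (cases "v = w n")
    case True
    then have "insert (Suc n) (nbrs w n v) = insert (Suc n) (leaf_nbrs w n v)"
      using step(6) Nv Lv \<open>v \<noteq> Suc n\<close> by simp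
    then have "nbrs w n v = leaf_nbrs w n v" using Sn insert_ident[of "Suc n" "nbrs w n v"] by simp
    then have "insert v (nbrs w n v) = {1..n}" using step.IH[OF a v] by blast
    moreover have "insert v (nbrs w (Suc n) v) = insert (Suc n) (insert v (nbrs w n v))"
      using Nv True \<open>v \<noteq> Suc n\<close> by auto
    ultimately show ?thesis by (simp add: atLeastAtMostSuc_conv)
  next
    case False
    then have *: "nbrs w n v = leaf_nbrs w n v - {w n}" using step(6) Nv Lv \<open>v \<noteq> Suc n\<close> by auto
    then have "nbrs w n v = leaf_nbrs w n v" using leaf_nbrs_subset[of w n v] by auto
    then have "w n \<in> insert v (nbrs w n v)" using step.IH[OF a v] w by blast
    then show ?thesis using * False by auto
  qed
qed

lemma leaf_count_eq_degree_imp_star: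
  assumes "2 \<le> n" "attachment_seq n w" "v \<in> {1..n}" "leaf_count w n v = tree_degree w n v"
  shows "Suc (tree_degree w n v) = n"
proof -
  have "leaf_nbrs w n v = nbrs w n v"
    using assms(4) card_subset_eq[OF finite_nbrs[OF assms(1,2)] leaf_nbrs_subset]
    by (simp add: leaf_count_def tree_degree_def)
  then have "insert v (nbrs w n v) = {1..n}" using only_leaf_nbrs_imp_star assms by metis
  moreover have "card (insert v (nbrs w n v)) = Suc (tree_degree w n v)"
    using nbrs_subset[OF assms(1,2), of v] finite_nbrs[OF assms(1,2), of v]
    by (subst card_insert_disjoint) (auto simp: tree_degree_def)
  ultimately show ?thesis by simp
qed

text \<open>
  Every vertex has degree one when it enters the tree, so any further neighbour is a child.
\<close>
lemma nonleaf_has_child: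
  assumes "2 \<le> n" "attachment_seq n w" "2 \<le> tree_degree w n v"
  shows "\<exists>k\<in>{3..n}. w (k - 1) = v"
  using assms
proof (induction n rule: dec_induct)
  case base
  then show ?case by (auto simp: tree_degree_def nbrs_2 split: if_splits)
next
  case (step n)
  then have w: "w n \<in> {1..n}" and a: "attachment_seq n w" and n: "2 \<le> n"
    by (auto simp: attachment_seq_Suc)
  show ?case
  proof (cases "v = w n")
    case True
    then show ?thesis using n by (intro bexI[of _ "Suc n"]) auto
  next
    case False
    then have "tree_degree w n v \<ge> 2" using degree_step[OF n a w, of v] step(5) by (auto split: if_splits)
    then show ?thesis using step.IH[OF a] by auto
  qed
qed

lemma child_edge: "3 \<le> k \<Longrightarrow> k \<le> n \<Longrightarrow> k \<in> nbrs w n (w (k - 1))"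
  using nbrs_mono[of k n w "w (k - 1)"] by (cases k) (auto simp: neighbours_def friend_tree.simps(2))

section \<open>The attachment kernel\<close>

text \<open>
  The probability that vertex \<open>n + 1\<close> is joined to \<open>b\<close>: the uniform vertex has to be some
  neighbour \<open>a\<close> of \<open>b\<close>, and \<open>a\<close> then passes the choice on to \<open>b\<close>.
\<close>
definition attach_prob :: "(nat \<Rightarrow> nat) \<Rightarrow> nat \<Rightarrow> nat \<Rightarrow> real" where
  "attach_prob w n b = (\<Sum>a\<in>nbrs w n b. 1 / real (tree_degree w n a)) / real n"

lemma attach_prob_nonneg: "0 \<le> attach_prob w n b"
  by (simp add: attach_prob_def sum_nonneg)

lemma sum_nbrs_swap:
  fixes F :: "nat \<Rightarrow> nat \<Rightarrow> real"
  assumes "2 \<le> n" "attachment_seq n w"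
  shows "(\<Sum>b\<in>{1..n}. \<Sum>a\<in>nbrs w n b. F a b) = (\<Sum>a\<in>{1..n}. \<Sum>b\<in>nbrs w n a. F a b)"
proof -
  have *: "nbrs w n b = {a \<in> {1..n}. a \<in> nbrs w n b}" for b
    using nbrs_subset[OF assms, of b] by auto
  have **: "{b \<in> {1..n}. a \<in> nbrs w n b} = nbrs w n a" for a
    using nbrs_subset[OF assms, of a] nbrs_sym[of a w n] by blast
  have "(\<Sum>b\<in>{1..n}. \<Sum>a\<in>nbrs w n b. F a b) = (\<Sum>b\<in>{1..n}. \<Sum>a\<in>{a \<in> {1..n}. a \<in> nbrs w n b}. F a b)"
    by (rule sum.cong[OF refl]) (rule sum.cong[OF * refl])
  also have "\<dots> = (\<Sum>a\<in>{1..n}. \<Sum>b\<in>{b \<in> {1..n}. a \<in> nbrs w n b}. F a b)"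
    by (rule sum.swap_restrict) auto
  also have "\<dots> = (\<Sum>a\<in>{1..n}. \<Sum>b\<in>nbrs w n a. F a b)"
    by (simp only: **)
  finally show ?thesis .
qed

lemma sum_attach_prob:
  assumes "2 \<le> n" "attachment_seq n w"
  shows "(\<Sum>b\<in>{1..n}. attach_prob w n b) = 1"
proof -
  have "(\<Sum>b\<in>{1..n}. attach_prob w n b)
      = (\<Sum>b\<in>{1..n}. \<Sum>a\<in>nbrs w n b. 1 / real (tree_degree w n a)) / n"
    by (simp add: attach_prob_def sum_divide_distrib)
  also have "\<dots> = (\<Sum>a\<in>{1..n}. \<Sum>b\<in>nbrs w n a. 1 / real (tree_degree w n a)) / n"
    by (rule arg_cong[where f = "\<lambda>x. x / real n"], rule sum_nbrs_swap[OF assms])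
  also have "\<dots> = (\<Sum>a\<in>{1..n}. 1) / real n"
    using degree_pos[OF assms] by (intro arg_cong2[where f="(/)"] sum.cong) (force simp: tree_degree_def)+
  finally show ?thesis using assms by simp
qed

text \<open>
  A chosen leaf has no alternative to the vertex next to it.
\<close>
lemma attach_prob_ge:
  assumes "2 \<le> n" "attachment_seq n w"
  shows "real (leaf_count w n u) / n \<le> attach_prob w n u"
proof -
  have "real (leaf_count w n u) = (\<Sum>a\<in>leaf_nbrs w n u. 1 / real (tree_degree w n a))"
    by (simp add: leaf_count_def leaf_nbrs_def)
  also have "\<dots> \<le> (\<Sum>a\<in>nbrs w n u. 1 / real (tree_degree w n a))"
    by (intro sum_mono2 finite_nbrs assms leaf_nbrs_subset) auto
  finally show ?thesis by (simp add: attach_prob_def divide_right_mono)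
qed

lemma attach_prob_leaf:
  assumes "b \<in> leaf_nbrs w n u"
  shows "attach_prob w n b = 1 / (real (tree_degree w n u) * n)"
  by (simp add: attach_prob_def nbrs_leaf[OF assms])

text \<open>
  Seen from \<open>u\<close>, an attachment matters only if it is at \<open>u\<close>, with probability at least \<open>L / n\<close>, or
  at a leaf next to \<open>u\<close>, with probability exactly \<open>L / (D n)\<close>. The exact probability of the first
  event depends on the degrees of all neighbours of \<open>u\<close>; if \<open>g\<close> decreases along such an attachment,
  the lower bound is all that is needed.
\<close>
lemma vertex_step_expectation:
  fixes g :: "nat \<Rightarrow> nat \<Rightarrow> real"
  assumes n: "2 \<le> n" and a: "attachment_seq n w" and u: "u \<in> {1..n}"
    and DL: "D = tree_degree w n u" "L = leaf_count w n u"
    and g: "g (Suc D) (Suc L) \<le> g D L"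
  shows "(\<Sum>b\<in>{1..n}. attach_prob w n b *
            g (tree_degree (w(n := b)) (Suc n) u) (leaf_count (w(n := b)) (Suc n) u))
     \<le> g D L + L / n * (g (Suc D) (Suc L) - g D L) + L / (D * n) * (g D (L - 1) - g D L)"
proof -
  have nu: "u \<notin> leaf_nbrs w n u" using nbrs_subset[OF n a, of u] leaf_nbrs_subset[of w n u] by auto
  have sub: "leaf_nbrs w n u \<subseteq> {1..n}" using nbrs_subset[OF n a, of u] leaf_nbrs_subset[of w n u] by auto
  have "(\<Sum>b\<in>{1..n}. attach_prob w n b *
            g (tree_degree (w(n := b)) (Suc n) u) (leaf_count (w(n := b)) (Suc n) u))
     = (\<Sum>b\<in>{1..n}. attach_prob w n b * g D L
          + (if b = u then attach_prob w n u * (g (Suc D) (Suc L) - g D L) else 0)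
          + (if b \<in> leaf_nbrs w n u then 1 / (D * real n) * (g D (L - 1) - g D L) else 0))"
  proof (intro sum.cong refl)
    fix b assume b: "b \<in> {1..n}"
    then have "b \<noteq> Suc n" "u \<noteq> Suc n" using u by auto
    then show "attach_prob w n b *
            g (tree_degree (w(n := b)) (Suc n) u) (leaf_count (w(n := b)) (Suc n) u)
      = attach_prob w n b * g D L
          + (if b = u then attach_prob w n u * (g (Suc D) (Suc L) - g D L) else 0)
          + (if b \<in> leaf_nbrs w n u then 1 / (D * real n) * (g D (L - 1) - g D L) else 0)"
      unfolding degree_step[OF n a b] leaf_count_step[OF n a b u] DL[symmetric]
      using nu attach_prob_leaf[of b w n u, folded DL(1)]
      by (cases "b = u"; cases "b \<in> leaf_nbrs w n u") (simp_all add: right_diff_distrib)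
  qed
  also have "\<dots> = g D L + attach_prob w n u * (g (Suc D) (Suc L) - g D L)
          + L / (D * n) * (g D (L - 1) - g D L)"
    using u sub
    by (simp add: sum.distrib sum_attach_prob[OF n a, unfolded One_nat_def] sum.delta flip: sum_distrib_right)
       (simp add: sum.If_cases Int_absorb1 DL(2) leaf_count_def)
  also have "attach_prob w n u * (g (Suc D) (Suc L) - g D L) \<le> L / n * (g (Suc D) (Suc L) - g D L)"
    using attach_prob_ge[OF n a, of u] g DL by (intro mult_right_mono_neg) auto
  finally show ?thesis by simp
qed

section \<open>Attachments to leaves\<close>

text \<open>
  Summing over leaves instead of over their neighbours shows that this is \<open>n\<close> times the probability
  of attaching to a leaf. Its virtue is that it never decreases and has a drift proportional to
  itself.
\<close>
definition leaf_weight :: "(nat \<Rightarrow> nat) \<Rightarrow> nat \<Rightarrow> real" where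
  "leaf_weight w n = (\<Sum>v\<in>{1..n}. real (leaf_count w n v) / real (tree_degree w n v))"

text \<open>
  The first difference is the new contribution of \<open>b\<close> minus the old one. The last term is what the
  vertex next to \<open>b\<close> loses if \<open>b\<close> was a leaf.
\<close>
definition weight_gain :: "(nat \<Rightarrow> nat) \<Rightarrow> nat \<Rightarrow> nat \<Rightarrow> real" where
  "weight_gain w n b = real (leaf_count w n b + 1) / real (tree_degree w n b + 1)
     - real (leaf_count w n b) / real (tree_degree w n b)
     - (if tree_degree w n b = 1 then (\<Sum>v\<in>nbrs w n b. 1 / real (tree_degree w n v)) else 0)"

lemma leaf_weight_step:
  assumes n: "2 \<le> n" and a: "attachment_seq n w" and b: "b \<in> {1..n}"
  shows "leaf_weight (w(n := b)) (Suc n) = leaf_weight w n + weight_gain w n b"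
proof -
  let ?w = "w(n := b)"
  have "leaf_nbrs ?w (Suc n) (Suc n) = {}"
    using degree_pos[OF n a b] b
    by (auto simp: leaf_nbrs_def nbrs_step[OF n a b] degree_step[OF n a b])
  then have new: "leaf_count ?w (Suc n) (Suc n) = 0" by (simp add: leaf_count_def)
  have old: "real (leaf_count ?w (Suc n) v) / real (tree_degree ?w (Suc n) v)
      = real (leaf_count w n v) / real (tree_degree w n v)
        + (if v = b then real (leaf_count w n b + 1) / real (tree_degree w n b + 1)
             - real (leaf_count w n b) / real (tree_degree w n b) else 0)
        - (if b \<in> leaf_nbrs w n v then 1 / real (tree_degree w n v) else 0)"
    if v: "v \<in> {1..n}" for v
  proof -
    have "v \<noteq> Suc n" using v by auto
    have "b \<notin> leaf_nbrs w n b" using nbrs_subset[OF n a, of b] leaf_nbrs_subset[of w n b] by auto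
    moreover have "real (leaf_count w n v - 1) = real (leaf_count w n v) - 1" if "b \<in> leaf_nbrs w n v"
    proof -
      have "leaf_count w n v \<noteq> 0"
        using that finite_leaf_nbrs[OF n a, of v] by (auto simp: leaf_count_def)
      then show ?thesis by (simp add: of_nat_diff)
    qed
    ultimately show ?thesis
      unfolding degree_step[OF n a b] leaf_count_step[OF n a b v] using \<open>v \<noteq> Suc n\<close>
      by (cases "v = b"; cases "b \<in> leaf_nbrs w n v") (simp_all add: diff_divide_distrib)
  qed
  have "(\<Sum>v\<in>{1..n}. if b \<in> leaf_nbrs w n v then 1 / real (tree_degree w n v) else 0)
      = (if tree_degree w n b = 1 then (\<Sum>v\<in>nbrs w n b. 1 / real (tree_degree w n v)) else 0)"
  proof (cases "tree_degree w n b = 1")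
    case True
    then have "{v \<in> {1..n}. b \<in> leaf_nbrs w n v} = nbrs w n b"
      using nbrs_subset[OF n a, of b] nbrs_sym[of b w n] unfolding leaf_nbrs_def by blast
    then show ?thesis using True by (simp only: sum.inter_filter[OF finite_atLeastAtMost, symmetric] if_True simp_thms)
  next
    case False
    then show ?thesis by (simp add: leaf_nbrs_def)
  qed
  then show ?thesis
    using b unfolding leaf_weight_def weight_gain_def
    by (simp add: new old sum.distrib sum_subtractf cong: sum.cong_simp del: One_nat_def)
qed

lemma leaf_neighbourhood:
  assumes "3 \<le> n" "attachment_seq n w" "tree_degree w n b = 1"
  obtains p where "nbrs w n b = {p}" "2 \<le> tree_degree w n p"
proof -
  obtain p where p: "nbrs w n b = {p}"
    using assms(3) by (auto simp: tree_degree_def card_1_singleton_iff)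
  then have "b \<in> leaf_nbrs w n p"
    using assms(3) nbrs_sym[of b w n p] by (auto simp: leaf_nbrs_def)
  then show thesis using that p leaf_parent_degree[OF assms(1,2)] by blast
qed

text \<open>
  An attachment at a leaf whose neighbour has degree \<open>D\<close> gains \<open>1 / 2 - 1 / D\<close>, and \<open>D \<ge> 2\<close>. An
  attachment at another vertex gains \<open>(D - L) / (D * (D + 1))\<close>.
\<close>
lemma weight_gain_bounds:
  assumes n: "3 \<le> n" and a: "attachment_seq n w" and b: "b \<in> {1..n}"
  shows "0 \<le> weight_gain w n b" "weight_gain w n b \<le> 1 / 2"
proof -
  define D L where "D = real (tree_degree w n b)" and "L = real (leaf_count w n b)"
  have n2: "2 \<le> n" using n by simp
  have "0 \<le> weight_gain w n b \<and> weight_gain w n b \<le> 1 / 2"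
  proof (cases "tree_degree w n b = 1")
    case True
    obtain p where p: "nbrs w n b = {p}" "2 \<le> tree_degree w n p"
      using leaf_neighbourhood[OF n a True] .
    then have "weight_gain w n b = 1 / 2 - 1 / real (tree_degree w n p)"
      using True leaf_count_eq_0_if_leaf[OF n a True] by (simp add: weight_gain_def)
    moreover have "1 / real (tree_degree w n p) \<le> 1 / 2" using p by (simp add: field_simps)
    ultimately show ?thesis by simp
  next
    case False
    then have D: "2 \<le> D" using degree_pos[OF n2 a b] by (simp add: D_def)
    have L: "0 \<le> L" "L \<le> D" using leaf_count_le_degree[OF n2 a] by (simp_all add: D_def L_def)
    have "weight_gain w n b = (L + 1) / (D + 1) - L / D"
      using False by (simp add: weight_gain_def D_def L_def add.commute)
    also have "\<dots> = (D - L) / (D * (D + 1))"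
      using D by (simp add: field_simps)
    finally have *: "weight_gain w n b = (D - L) / (D * (D + 1))" .
    have "(D - L) / (D * (D + 1)) \<le> D / (D * (D + 1))"
      using D L by (intro divide_right_mono) auto
    also have "\<dots> = 1 / (D + 1)" using D by simp
    also have "\<dots> \<le> 1 / 2" using D by (simp add: field_simps)
    finally show ?thesis using * D L by simp
  qed
  then show "0 \<le> weight_gain w n b" "weight_gain w n b \<le> 1 / 2" by auto
qed

text \<open>
  The right-hand side is \<open>L / D\<close> times \<open>(D - L) / (D + 1) + 1 / 2 - 1 / D\<close>. If some neighbour is
  not a leaf, this factor is at least \<open>1 / 2 - 1 / (D * (D + 1))\<close>, which is smallest for \<open>D = 2\<close>;
  if all neighbours are leaves, \<open>D \<ge> 6\<close> gives the same bound \<open>1 / 3\<close>.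
\<close>
lemma vertex_drift_bound:
  fixes D L :: real
  assumes "0 \<le> L" "L > 0 \<Longrightarrow> 2 \<le> D" "L \<le> D - 1 \<or> 6 \<le> D \<and> L \<le> D"
  shows "L / D / 3 \<le> L * (D - L) / (D * (D + 1)) + L * (1 / D * (1 / 2 - 1 / D))"
proof (cases "L = 0")
  case False
  then have L: "0 < L" and D: "2 \<le> D" using assms by auto
  have "1 / 3 \<le> (D - L) / (D + 1) + (1 / 2 - 1 / D)"
    using assms(3)
  proof
    assume "L \<le> D - 1"
    then have "1 / (D + 1) \<le> (D - L) / (D + 1)" using D by (intro divide_right_mono) auto
    moreover have "1 / 3 \<le> 1 / (D + 1) + (1 / 2 - 1 / D)"
    proof -
      have "6 \<le> D * (D + 1)" using mult_mono[of 2 D 3 "D + 1"] D by simp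
      then have "1 / (D * (D + 1)) \<le> 1 / 6" using D by (intro divide_left_mono) auto
      moreover have "1 / D - 1 / (D + 1) = 1 / (D * (D + 1))" using D by (simp add: field_simps)
      ultimately show ?thesis by linarith
    qed
    ultimately show ?thesis by linarith
  next
    assume *: "6 \<le> D \<and> L \<le> D"
    then have "0 \<le> (D - L) / (D + 1)" "1 / D \<le> 1 / 6" by (auto simp: field_simps)
    then show ?thesis by linarith
  qed
  then have "L / D * (1 / 3) \<le> L / D * ((D - L) / (D + 1) + (1 / 2 - 1 / D))"
    using L D by (intro mult_left_mono) auto
  then show ?thesis using D by (simp add: distrib_left)
qed simp

text \<open>
  The average gain is a sum over the vertices attached to. Moving the gains at leaves to the vertices
  next to them turns it into a sum of the expressions bounded in \<open>vertex_drift_bound\<close>. A vertex with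
  only leaves around it is the centre of a star and has degree \<open>n - 1\<close>; hence \<open>n \<ge> 7\<close>.
\<close>
lemma leaf_weight_drift:
  assumes n: "7 \<le> n" and a: "attachment_seq n w"
  shows "leaf_weight w n / (3 * n) \<le> (\<Sum>b\<in>{1..n}. attach_prob w n b * weight_gain w n b)"
proof -
  define D L where "D v = real (tree_degree w n v)" and "L v = real (leaf_count w n v)" for v
  define c where "c v = 1 / D v * (1 / 2 - 1 / D v)" for v
  have n2: "2 \<le> n" and n3: "3 \<le> n" using n by auto
  have *: "L b * (D b - L b) / (D b * (D b + 1)) + (\<Sum>p\<in>nbrs w n b. if tree_degree w n b = 1 then c p else 0)
      \<le> real n * (attach_prob w n b * weight_gain w n b)" if b: "b \<in> {1..n}" for b
  proof (cases "tree_degree w n b = 1")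
    case True
    obtain p where p: "nbrs w n b = {p}" "2 \<le> tree_degree w n p"
      using leaf_neighbourhood[OF n3 a True] .
    have "real n * attach_prob w n b = 1 / D p"
      using n p by (simp add: attach_prob_def D_def)
    moreover have "weight_gain w n b = 1 / 2 - 1 / D p"
      using True p leaf_count_eq_0_if_leaf[OF n3 a True] by (simp add: weight_gain_def D_def)
    ultimately show ?thesis
      using True p leaf_count_eq_0_if_leaf[OF n3 a True] by (simp add: L_def c_def mult.assoc[symmetric])
  next
    case False
    then have D: "2 \<le> D b" using degree_pos[OF n2 a b] by (simp add: D_def)
    have "weight_gain w n b = (L b + 1) / (D b + 1) - L b / D b"
      using False by (simp add: weight_gain_def D_def L_def add.commute)
    also have "\<dots> = (D b - L b) / (D b * (D b + 1))"
      using D by (simp add: field_simps)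
    finally have g: "weight_gain w n b = (D b - L b) / (D b * (D b + 1))" .
    have "L b \<le> real n * attach_prob w n b"
      using attach_prob_ge[OF n2 a, of b] n by (simp add: L_def field_simps)
    then have "L b * weight_gain w n b \<le> real n * attach_prob w n b * weight_gain w n b"
      using weight_gain_bounds(1)[OF n3 a b] by (intro mult_right_mono)
    then show ?thesis using False g by (simp add: mult.assoc)
  qed
  have swap: "(\<Sum>b\<in>{1..n}. \<Sum>p\<in>nbrs w n b. if tree_degree w n b = 1 then c p else 0)
      = (\<Sum>p\<in>{1..n}. L p * c p)"
    unfolding sum_nbrs_swap[OF n2 a, of "\<lambda>p b. if tree_degree w n b = 1 then c p else 0"]
    by (intro sum.cong refl)
       (simp add: L_def leaf_count_def leaf_nbrs_def sum.inter_filter[OF finite_nbrs[OF n2 a], symmetric])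
  have "leaf_weight w n / 3 = (\<Sum>v\<in>{1..n}. L v / D v / 3)"
    by (simp add: leaf_weight_def L_def D_def sum_divide_distrib)
  also have "\<dots> \<le> (\<Sum>v\<in>{1..n}. L v * (D v - L v) / (D v * (D v + 1)) + L v * c v)"
    unfolding c_def
  proof (intro sum_mono vertex_drift_bound)
    fix v assume v: "v \<in> {1..n}"
    show "0 \<le> L v" by (simp add: L_def)
    show "2 \<le> D v" if "0 < L v"
      using that leaf_count_eq_0_if_leaf[OF n3 a, of v] degree_pos[OF n2 a v]
      by (cases "tree_degree w n v = 1") (auto simp: L_def D_def)
    show "L v \<le> D v - 1 \<or> 6 \<le> D v \<and> L v \<le> D v"
      using leaf_count_le_degree[OF n2 a, of v] leaf_count_eq_degree_imp_star[OF n2 a v] n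
      by (cases "leaf_count w n v = tree_degree w n v") (auto simp: L_def D_def)
  qed
  also have "\<dots> = (\<Sum>b\<in>{1..n}. L b * (D b - L b) / (D b * (D b + 1))
      + (\<Sum>p\<in>nbrs w n b. if tree_degree w n b = 1 then c p else 0))"
    by (simp only: sum.distrib swap)
  also have "\<dots> \<le> (\<Sum>b\<in>{1..n}. real n * (attach_prob w n b * weight_gain w n b))"
    by (intro sum_mono *)
  also have "\<dots> = real n * (\<Sum>b\<in>{1..n}. attach_prob w n b * weight_gain w n b)"
    by (simp only: sum_distrib_left)
  finally show ?thesis using n by (simp add: field_simps)
qed

lemma leaf_weight_ge_1:
  assumes "3 \<le> n" "attachment_seq n w"
  shows "1 \<le> leaf_weight w n"
  using assms
proof (induction n rule: dec_induct)
  case base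
  have a: "attachment_seq 2 w" and w: "w 2 \<in> {1..2}"
    using base attachment_seq_Suc[of 2 w] by (auto simp: numeral_3_eq_3 numeral_2_eq_2)
  have w': "w 2 = 1 \<or> w 2 = 2" using w by auto
  have D: "tree_degree w 2 u = 1" if "u = 1 \<or> u = 2" for u
    using that by (auto simp: tree_degree_def nbrs_2)
  have "leaf_nbrs w 2 (w 2) = nbrs w 2 (w 2)"
    using w' D by (auto simp: leaf_nbrs_def nbrs_2)
  then have L: "leaf_count w 2 (w 2) = 1"
    using D[OF w'] by (simp add: leaf_count_def tree_degree_def)
  have "leaf_count w 3 (w 2) = 2" "tree_degree w 3 (w 2) = 2"
    using leaf_count_step[OF _ a w w] degree_step[OF _ a w, of "w 2"] L D[OF w'] w by auto
  then have "1 = real (leaf_count w 3 (w 2)) / real (tree_degree w 3 (w 2))" by simp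
  also have "\<dots> \<le> leaf_weight w 3"
    unfolding leaf_weight_def using w by (intro member_le_sum) auto
  finally show ?case .
next
  case (step n)
  then have w: "w n \<in> {1..n}" and a: "attachment_seq n w" and n: "2 \<le> n"
    by (auto simp: attachment_seq_Suc)
  show ?case
    using leaf_weight_step[OF n a w] weight_gain_bounds(1)[OF step(1) a w] step.IH[OF a] by simp
qed

lemma leaf_weight_le_card_nonleaves:
  assumes n: "3 \<le> n" and a: "attachment_seq n w"
  shows "leaf_weight w n \<le> card {v \<in> {1..n}. 2 \<le> tree_degree w n v}"
proof -
  have n2: "2 \<le> n" using n by simp
  have "leaf_weight w n \<le> (\<Sum>v\<in>{1..n}. if 2 \<le> tree_degree w n v then 1 else 0)"
    unfolding leaf_weight_def
  proof (intro sum_mono)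
    fix v assume v: "v \<in> {1..n}"
    have "real (leaf_count w n v) / real (tree_degree w n v) \<le> 1"
      using leaf_count_le_degree[OF n2 a, of v] degree_pos[OF n2 a v] by simp
    moreover have "leaf_count w n v = 0" if "\<not> 2 \<le> tree_degree w n v"
      using that degree_pos[OF n2 a v] by (intro leaf_count_eq_0_if_leaf[OF n a]) simp
    ultimately show "real (leaf_count w n v) / real (tree_degree w n v)
        \<le> (if 2 \<le> tree_degree w n v then 1 else 0)" by simp
  qed
  also have "\<dots> = card {v \<in> {1..n}. 2 \<le> tree_degree w n v}"
    by (simp add: sum.inter_filter[symmetric] del: One_nat_def)
  finally show ?thesis .
qed

text \<open>
  \<open>(1 + 1 / x) powr c\<close> is at most \<open>exp (c / x)\<close>, and \<open>1 - c / x\<close> is at most \<open>exp (- c / x)\<close>.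
\<close>
lemma powr_step_le:
  fixes c x :: real
  assumes "0 \<le> c" "0 < x"
  shows "(x + 1) powr c * (1 - c / x) \<le> x powr c"
proof -
  have "(x + 1) powr c = x powr c * (1 + 1 / x) powr c"
    using assms by (simp add: powr_mult[symmetric] distrib_left)
  also have "(1 + 1 / x) powr c = exp (c * ln (1 + 1 / x))"
    using add_pos_pos[of 1 "1 / x"] assms by (simp add: powr_def)
  also have "\<dots> \<le> exp (c / x)"
    using assms mult_left_mono[OF ln_add_one_self_le_self[of "1 / x"], of c] by simp
  finally have "(x + 1) powr c \<le> x powr c * exp (c / x)"
    using assms by (simp add: mult_left_mono)
  moreover have "1 - c / x \<le> exp (- (c / x))"
    using exp_ge_add_one_self[of "- (c / x)"] by simp
  ultimately have "(x + 1) powr c * (1 - c / x) \<le> (x powr c * exp (c / x)) * exp (- (c / x))"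
    using assms by (intro order_trans[OF mult_left_mono mult_right_mono]) auto
  then show ?thesis by (simp add: exp_minus mult.assoc)
qed
text \<open>
  With \<open>S \<ge> 1\<close> and a gain \<open>g \<le> 1 / 2\<close>, the inverse \<open>1 / S\<close> decreases by \<open>g / (S * (S + g))\<close>, which
  is at least \<open>2 / 3 * g / S\<^sup>2\<close>. As \<open>g\<close> is at least \<open>S / (3 n)\<close> on average, \<open>1 / S\<close> shrinks on
  average by the factor \<open>1 - (2 / 9) / n\<close>.
\<close>
lemma leaf_weight_inverse_step:
  assumes n: "7 \<le> n" and a: "attachment_seq n w"
  shows "(\<Sum>b\<in>{1..n}. attach_prob w n b * (real (Suc n) powr (2 / 9) / leaf_weight (w(n := b)) (Suc n)))
    \<le> real n powr (2 / 9) / leaf_weight w n"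
proof -
  define S where "S = leaf_weight w n"
  have n2: "2 \<le> n" and n3: "3 \<le> n" using n by auto
  have S: "1 \<le> S" unfolding S_def by (rule leaf_weight_ge_1[OF n3 a])
  have *: "1 / leaf_weight (w(n := b)) (Suc n) \<le> 1 / S - 2 / 3 * weight_gain w n b / S\<^sup>2"
    if b: "b \<in> {1..n}" for b
  proof -
    let ?g = "weight_gain w n b"
    have g: "0 \<le> ?g" "?g \<le> 1 / 2" using weight_gain_bounds[OF n3 a b] by auto
    have "2 / 3 * ?g / S\<^sup>2 = ?g / (S * (3 / 2 * S))" by (simp add: power2_eq_square)
    also have "\<dots> \<le> ?g / (S * (S + ?g))"
      using S g by (intro divide_left_mono mult_left_mono mult_pos_pos) auto
    also have "\<dots> = 1 / S - 1 / (S + ?g)" using S g by (simp add: field_simps)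
    finally show ?thesis unfolding leaf_weight_step[OF n2 a b] S_def by simp
  qed
  have "(\<Sum>b\<in>{1..n}. attach_prob w n b * (1 / leaf_weight (w(n := b)) (Suc n)))
      \<le> (\<Sum>b\<in>{1..n}. attach_prob w n b * (1 / S - 2 / 3 * weight_gain w n b / S\<^sup>2))"
    by (intro sum_mono mult_left_mono * attach_prob_nonneg)
  also have "\<dots> = (\<Sum>b\<in>{1..n}. attach_prob w n b) * (1 / S)
      - 2 / 3 / S\<^sup>2 * (\<Sum>b\<in>{1..n}. attach_prob w n b * weight_gain w n b)"
    unfolding sum_distrib_left sum_distrib_right sum_subtractf[symmetric]
    by (intro sum.cong refl) (simp add: algebra_simps)
  also have "\<dots> \<le> 1 / S - 2 / 3 / S\<^sup>2 * (S / (3 * n))"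
    using leaf_weight_drift[OF n a] sum_attach_prob[OF n2 a] S unfolding S_def
    by (intro diff_mono mult_left_mono) auto
  also have "\<dots> = (1 - (2 / 9) / real n) / S"
    using S n by (simp add: power2_eq_square field_simps)
  finally have inv: "(\<Sum>b\<in>{1..n}. attach_prob w n b * (1 / leaf_weight (w(n := b)) (Suc n)))
      \<le> (1 - (2 / 9) / real n) / S" .
  have "(\<Sum>b\<in>{1..n}. attach_prob w n b * (real (Suc n) powr (2 / 9) / leaf_weight (w(n := b)) (Suc n)))
      = real (Suc n) powr (2 / 9) * (\<Sum>b\<in>{1..n}. attach_prob w n b * (1 / leaf_weight (w(n := b)) (Suc n)))"
    unfolding sum_distrib_left by (intro sum.cong refl) simp
  also have "\<dots> \<le> real (Suc n) powr (2 / 9) * ((1 - (2 / 9) / real n) / S)"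
    by (intro mult_left_mono inv) simp
  also have "\<dots> = (real n + 1) powr (2 / 9) * (1 - (2 / 9) / real n) / S"
    by (simp add: add.commute)
  also have "\<dots> \<le> real n powr (2 / 9) / S"
    using S n by (intro divide_right_mono powr_step_le) auto
  finally show ?thesis unfolding S_def .
qed

section \<open>A maximal inequality\<close>

text \<open>
  Adaptedness: the value at time \<open>n\<close> depends only on the tree at time \<open>n\<close> and its history. It makes
  values on sequences with arbitrary entries outside \<open>{2..<n}\<close> meaningful.
\<close>
definition determined_by_past :: "(nat \<Rightarrow> (nat \<Rightarrow> nat) \<Rightarrow> 'b) \<Rightarrow> bool" where
  "determined_by_past y \<longleftrightarrow> (\<forall>n w w'. (\<forall>i\<in>{2..<n}. w i = w' i) \<longrightarrow> y n w = y n w')"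

lemma determined_by_past_update:
  "determined_by_past y \<Longrightarrow> j \<le> n \<Longrightarrow> y j (w(n := b)) = y j w"
  unfolding determined_by_past_def by (metis atLeastLessThan_iff fun_upd_other leD order.strict_trans2)

lemma friend_tree_cong': "\<forall>i\<in>{2..<n}. w i = w' i \<Longrightarrow> friend_tree w n = friend_tree w' n"
  by (rule friend_tree_cong) auto

context random_friend_tree
begin

text \<open>
  The past up to time \<open>n\<close> takes finitely many values of positive probability, so expectations of
  functions of the past are finite sums, free of integrability conditions. The paths record the
  chosen vertices \<open>V\<close> along with \<open>W\<close>, because the law of the process is given on joint histories.
\<close>
definition paths :: "nat \<Rightarrow> (nat \<Rightarrow> nat \<times> nat) set" where
  "paths n = PiE {2..<n} (\<lambda>i. {1..i} \<times> {1..i})"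

definition path_event :: "nat \<Rightarrow> (nat \<Rightarrow> nat \<times> nat) \<Rightarrow> 'w set" where
  "path_event n p = history M V W (fst \<circ> p) (snd \<circ> p) n"

definition path_expectation :: "nat \<Rightarrow> ((nat \<Rightarrow> nat) \<Rightarrow> real) \<Rightarrow> real" where
  "path_expectation n \<phi> = (\<Sum>p\<in>paths n. prob (path_event n p) * \<phi> (snd \<circ> p))"

definition valid_upto :: "nat \<Rightarrow> 'w \<Rightarrow> bool" where
  "valid_upto n \<omega> \<longleftrightarrow> (\<forall>i\<in>{2..<n}. V i \<omega> \<in> {1..i} \<and> W i \<omega> \<in> {1..i})"

lemma finite_paths: "finite (paths n)"
  unfolding paths_def by (intro finite_PiE) auto

lemma attachment_seq_path: "p \<in> paths n \<Longrightarrow> attachment_seq n (snd \<circ> p)"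
  by (auto simp: attachment_seq_def paths_def dest!: PiE_mem)

lemma path_event_in_sets: "path_event n p \<in> events"
proof -
  have "{\<omega> \<in> space M. V i \<omega> = a} \<in> events" "{\<omega> \<in> space M. W i \<omega> = a} \<in> events" if "2 \<le> i" for i a
    using measurable_sets[OF measurable_V[OF that], of "{a}"] measurable_sets[OF measurable_W[OF that], of "{a}"]
    by (auto simp: vimage_def Int_def conj_commute)
  then show ?thesis
    unfolding path_event_def history_def
    by (intro sets.sets_Collect_finite_All sets.sets_Collect_conj) auto
qed

lemma prob_path_event_Suc:
  assumes n: "2 \<le> n" and p: "p \<in> paths n" and a: "a \<in> {1..n}"
  shows "prob (path_event (Suc n) (p(n := (a, b)))) =
    prob (path_event n p) * ((if b \<in> nbrs (snd \<circ> p) n a then 1 / tree_degree (snd \<circ> p) n a else 0) / n)"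
proof -
  let ?w = "snd \<circ> p"
  have as: "attachment_seq n ?w" by (rule attachment_seq_path[OF p])
  have "nbrs ?w n a \<noteq> {}"
    using degree_pos[OF n as a] by (auto simp: tree_degree_def)
  then have pmf: "pmf (pmf_of_set (nbrs ?w n a)) b = (if b \<in> nbrs ?w n a then 1 / tree_degree ?w n a else 0)"
    using finite_nbrs[OF n as, of a] by (simp add: indicator_def tree_degree_def)
  have "path_event (Suc n) (p(n := (a, b))) = {\<omega> \<in> path_event n p. V n \<omega> = a \<and> W n \<omega> = b}"
    using n by (auto simp: path_event_def history_def atLeastLessThanSuc)
  then have "prob (path_event (Suc n) (p(n := (a, b))))
    = prob (path_event n p) * pmf (pmf_of_set {1..n}) a * pmf (pmf_of_set (nbrs ?w n a)) b"
    using W_uniform[OF n, of "fst \<circ> p" ?w a b] V_uniform[OF n, of "fst \<circ> p" ?w a]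
    by (simp add: path_event_def)
  also have "pmf (pmf_of_set {1..n}) a = 1 / n"
    using a by simp
  finally show ?thesis
    unfolding pmf by (simp only: mult_ac times_divide_eq_left times_divide_eq_right mult_1_right mult_1_left)
qed

text \<open>
  Averaging over the last step: summing out the uniform vertex \<open>a\<close> leaves \<open>attach_prob\<close>.
\<close>
lemma path_expectation_Suc:
  assumes n: "2 \<le> n"
  shows "path_expectation (Suc n) \<phi> =
    path_expectation n (\<lambda>w. \<Sum>b\<in>{1..n}. attach_prob w n b * \<phi> (w(n := b)))"
proof -
  let ?S = "{1..n} \<times> {1..n}"
  have eq: "paths (Suc n) = (\<lambda>(y, g). g(n := y)) ` (?S \<times> paths n)"
    using n by (simp add: paths_def atLeastLessThanSuc PiE_insert_eq)
  have inj: "inj_on (\<lambda>(y, g). g(n := y)) (?S \<times> paths n)"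
    unfolding paths_def using inj_combinator[of n "{2..<n}" "\<lambda>i. {1..i} \<times> {1..i}"] by simp
  have "path_expectation (Suc n) \<phi> = (\<Sum>(y, p)\<in>?S \<times> paths n.
      prob (path_event (Suc n) (p(n := y))) * \<phi> (snd \<circ> p(n := y)))"
    unfolding path_expectation_def eq by (subst sum.reindex[OF inj]) (simp add: case_prod_unfold)
  also have "\<dots> = (\<Sum>p\<in>paths n. \<Sum>a\<in>{1..n}. \<Sum>b\<in>{1..n}.
      prob (path_event (Suc n) (p(n := (a, b)))) * \<phi> (snd \<circ> p(n := (a, b))))"
    by (subst sum.cartesian_product[symmetric], subst sum.swap) (simp add: sum.cartesian_product)
  also have "\<dots> = (\<Sum>p\<in>paths n. \<Sum>b\<in>{1..n}. \<Sum>a\<in>{1..n}.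
      prob (path_event (Suc n) (p(n := (a, b)))) * \<phi> (snd \<circ> p(n := (a, b))))"
    by (intro sum.cong refl sum.swap)
  also have "\<dots> = (\<Sum>p\<in>paths n. \<Sum>b\<in>{1..n}.
      prob (path_event n p) * (attach_prob (snd \<circ> p) n b * \<phi> ((snd \<circ> p)(n := b))))"
  proof (intro sum.cong refl)
    fix p b assume p: "p \<in> paths n" and b: "b \<in> {1..n}"
    let ?w = "snd \<circ> p"
    have as: "attachment_seq n ?w" by (rule attachment_seq_path[OF p])
    have w: "snd \<circ> p(n := (a, b)) = ?w(n := b)" for a by auto
    have set: "{a \<in> {1..n}. b \<in> nbrs ?w n a} = nbrs ?w n b"
      using nbrs_subset[OF n as, of b] nbrs_sym[of b ?w n] by blast
    have "attach_prob ?w n b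
        = (\<Sum>a\<in>{a \<in> {1..n}. b \<in> nbrs ?w n a}. 1 / real (tree_degree ?w n a)) / n"
      by (simp only: attach_prob_def set)
    also have "\<dots> = (\<Sum>a\<in>{1..n}. (if b \<in> nbrs ?w n a then 1 / real (tree_degree ?w n a) else 0) / n)"
      by (simp only: sum.inter_filter[OF finite_atLeastAtMost] sum_divide_distrib)
    finally have *: "(\<Sum>a\<in>{1..n}. (if b \<in> nbrs ?w n a then 1 / real (tree_degree ?w n a) else 0) / n)
        = attach_prob ?w n b" ..
    have "(\<Sum>a\<in>{1..n}. prob (path_event (Suc n) (p(n := (a, b)))) * \<phi> (snd \<circ> p(n := (a, b))))
      = (\<Sum>a\<in>{1..n}. (prob (path_event n p) * \<phi> (?w(n := b)))
          * ((if b \<in> nbrs ?w n a then 1 / real (tree_degree ?w n a) else 0) / n))"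
      unfolding w by (intro sum.cong refl) (simp only: prob_path_event_Suc[OF n p] mult_ac)
    also have "\<dots> = (prob (path_event n p) * \<phi> (?w(n := b))) * attach_prob ?w n b"
      by (simp only: sum_distrib_left[symmetric] *)
    finally show "(\<Sum>a\<in>{1..n}. prob (path_event (Suc n) (p(n := (a, b)))) * \<phi> (snd \<circ> p(n := (a, b))))
      = prob (path_event n p) * (attach_prob ?w n b * \<phi> (?w(n := b)))"
      by (simp only: mult_ac)
  qed
  finally show ?thesis by (simp add: path_expectation_def sum_distrib_left)
qed

lemma path_expectation_mono:
  assumes "\<And>w. attachment_seq n w \<Longrightarrow> \<phi> w \<le> \<psi> w"
  shows "path_expectation n \<phi> \<le> path_expectation n \<psi>"
  unfolding path_expectation_def
  by (intro sum_mono mult_left_mono assms attachment_seq_path) auto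

lemma path_expectation_one:
  assumes "2 \<le> n"
  shows "path_expectation n (\<lambda>_. 1) = 1"
  using assms
proof (induction n rule: dec_induct)
  case base
  show ?case by (simp add: path_expectation_def paths_def path_event_def history_def prob_space)
next
  case (step n)
  have "path_expectation (Suc n) (\<lambda>_. 1) = path_expectation n (\<lambda>w. \<Sum>b\<in>{1..n}. attach_prob w n b)"
    using path_expectation_Suc[OF step(1), of "\<lambda>_. 1"] by simp
  also have "\<dots> = path_expectation n (\<lambda>_. 1)"
    using sum_attach_prob[OF step(1)]
    by (intro antisym path_expectation_mono) (simp_all only: order_refl)
  finally show ?case using step by simp
qed

lemma prob_eq_path_expectation:
  assumes Q: "determined_by_past Q"
  shows "{\<omega> \<in> space M. valid_upto n \<omega> \<and> Q n (\<lambda>i. W i \<omega>)} \<in> events" (is "?E \<in> _")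
    and "prob {\<omega> \<in> space M. valid_upto n \<omega> \<and> Q n (\<lambda>i. W i \<omega>)} = path_expectation n (\<lambda>w. of_bool (Q n w))"
proof -
  let ?P = "{p \<in> paths n. Q n (snd \<circ> p)}"
  have eq: "?E = (\<Union>p\<in>?P. path_event n p)"
  proof (intro equalityI subsetI)
    fix \<omega> assume \<omega>: "\<omega> \<in> ?E"
    define p where "p = (\<lambda>i\<in>{2..<n}. (V i \<omega>, W i \<omega>))"
    have "p \<in> paths n" using \<omega> by (auto simp: p_def paths_def valid_upto_def)
    moreover have "Q n (snd \<circ> p) = Q n (\<lambda>i. W i \<omega>)"
      using Q by (auto simp: determined_by_past_def p_def)
    moreover have "\<omega> \<in> path_event n p" using \<omega> by (auto simp: p_def path_event_def history_def)
    ultimately show "\<omega> \<in> (\<Union>p\<in>?P. path_event n p)" using \<omega> by blast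
  next
    fix \<omega> assume "\<omega> \<in> (\<Union>p\<in>?P. path_event n p)"
    then obtain p where p: "p \<in> paths n" "Q n (snd \<circ> p)" "\<omega> \<in> path_event n p" by blast
    then have \<omega>: "\<omega> \<in> space M" "\<And>i. i \<in> {2..<n} \<Longrightarrow> V i \<omega> = fst (p i) \<and> W i \<omega> = snd (p i)"
      by (auto simp: path_event_def history_def)
    have "Q n (snd \<circ> p) = Q n (\<lambda>i. W i \<omega>)"
      using Q \<omega> unfolding determined_by_past_def by (metis comp_apply)
    moreover have "valid_upto n \<omega>"
      unfolding valid_upto_def
    proof
      fix i assume i: "i \<in> {2..<n}"
      then have "p i \<in> {1..i} \<times> {1..i}" using p(1) by (auto simp: paths_def dest!: PiE_mem)
      then show "V i \<omega> \<in> {1..i} \<and> W i \<omega> \<in> {1..i}" using \<omega>(2)[OF i] by (auto simp: mem_Times_iff)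
    qed
    ultimately show "\<omega> \<in> ?E" using \<omega> p by auto
  qed
  have fin: "finite ?P" using finite_paths by auto
  show "?E \<in> events" unfolding eq using path_event_in_sets fin by auto
  have "disjoint_family_on (path_event n) ?P"
    unfolding disjoint_family_on_def
  proof (intro ballI impI)
    fix p q assume pq: "p \<in> ?P" "q \<in> ?P" "p \<noteq> q"
    then obtain i where "i \<in> {2..<n}" "p i \<noteq> q i"
      by (metis (no_types, lifting) PiE_ext mem_Collect_eq paths_def)
    then show "path_event n p \<inter> path_event n q = {}"
      by (auto simp: path_event_def history_def prod_eq_iff)
  qed
  then have "prob ?E = (\<Sum>p\<in>?P. prob (path_event n p))"
    unfolding eq using fin path_event_in_sets by (intro finite_measure_finite_Union) auto
  also have "\<dots> = (\<Sum>p\<in>paths n. if Q n (snd \<circ> p) then prob (path_event n p) else 0)"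
    by (rule sum.inter_filter[OF finite_paths])
  also have "\<dots> = path_expectation n (\<lambda>w. of_bool (Q n w))"
    unfolding path_expectation_def by (intro sum.cong) auto
  finally show "prob ?E = path_expectation n (\<lambda>w. of_bool (Q n w))" .
qed

lemma AE_valid: "AE \<omega> in M. \<forall>n. valid_upto n \<omega>"
proof -
  have "AE \<omega> in M. valid_upto n \<omega>" if "2 \<le> n" for n
  proof -
    have d: "determined_by_past (\<lambda>_ _. True)" by (simp add: determined_by_past_def)
    have "prob {\<omega> \<in> space M. valid_upto n \<omega>} = 1"
      using prob_eq_path_expectation(2)[OF d, of n] path_expectation_one[OF that] by simp
    then show ?thesis
      using prob_eq_path_expectation(1)[OF d, of n] by (subst (asm) prob_Collect_eq_1) auto
  qed
  then have "AE \<omega> in M. \<forall>n. valid_upto (n + 2) \<omega>" by (simp add: AE_all_countable)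
  then show ?thesis
  proof eventually_elim
    case (elim \<omega>)
    show ?case
    proof
      fix n
      show "valid_upto n \<omega>" using elim[rule_format, of n] by (auto simp: valid_upto_def)
    qed
  qed
qed

lemma AE_attachment_seq: "AE \<omega> in M. \<forall>n. attachment_seq n (\<lambda>i. W i \<omega>)"
  using AE_valid by eventually_elim (auto simp: valid_upto_def attachment_seq_def)

text \<open>
  Freezing \<open>y\<close> at the level \<open>c\<close> once it has reached \<open>c\<close> keeps the supermartingale property, because
  freezing only lowers the value. The frozen process is \<open>c\<close> on the event in question, so
  Markov's inequality applies to it.
\<close>
lemma maximal_inequality:
  fixes y :: "nat \<Rightarrow> (nat \<Rightarrow> nat) \<Rightarrow> real"
  assumes past: "determined_by_past y"
    and nonneg: "\<And>n w. N \<le> n \<Longrightarrow> attachment_seq n w \<Longrightarrow> 0 \<le> y n w"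
    and super: "\<And>n w. N \<le> n \<Longrightarrow> attachment_seq n w \<Longrightarrow>
      (\<Sum>b\<in>{1..n}. attach_prob w n b * y (Suc n) (w(n := b))) \<le> y n w"
    and N: "2 \<le> N" "N \<le> n" and "0 < c"
  shows "path_expectation n (\<lambda>w. of_bool (\<exists>j\<in>{N..n}. c \<le> y j w)) \<le> path_expectation N (y N) / c"
proof -
  \<comment> \<open>\<open>y\<close> frozen at level \<open>c\<close> from the first time it reaches it\<close>
  define z where "z n w = (if \<exists>j\<in>{N..n}. c \<le> y j w then c else y n w)" for n w
  have z_step: "(\<Sum>b\<in>{1..n}. attach_prob w n b * z (Suc n) (w(n := b))) \<le> z n w"
    if n: "N \<le> n" and w: "attachment_seq n w" for n w
  proof (cases "\<exists>j\<in>{N..n}. c \<le> y j w")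
    case True
    then have "z (Suc n) (w(n := b)) = c" for b
      using determined_by_past_update[OF past, of _ n w b] by (force simp: z_def)
    moreover have "z n w = c" using True by (simp add: z_def)
    ultimately show ?thesis
      using sum_attach_prob[of n w] n N w by (simp flip: sum_distrib_right)
  next
    case False
    then have "z (Suc n) (w(n := b)) \<le> y (Suc n) (w(n := b))" for b
      using determined_by_past_update[OF past, of _ n w b]
      by (auto simp: z_def le_Suc_eq not_le) (metis atLeastAtMost_iff leD)
    then have "(\<Sum>b\<in>{1..n}. attach_prob w n b * z (Suc n) (w(n := b)))
        \<le> (\<Sum>b\<in>{1..n}. attach_prob w n b * y (Suc n) (w(n := b)))"
      by (intro sum_mono mult_left_mono attach_prob_nonneg)
    also have "\<dots> \<le> y n w" by (rule super[OF n w])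
    also have "\<dots> = z n w" using False by (simp add: z_def)
    finally show ?thesis .
  qed
  have "path_expectation n (z n) \<le> path_expectation N (z N)"
    using \<open>N \<le> n\<close>
  proof (induction n rule: dec_induct)
    case (step n)
    have "path_expectation (Suc n) (z (Suc n)) \<le> path_expectation n (z n)"
      unfolding path_expectation_Suc[OF order_trans[OF N(1) step(1)]]
      by (rule path_expectation_mono[OF z_step[OF step(1)]])
    with step show ?case by simp
  qed simp
  also have "\<dots> \<le> path_expectation N (y N)"
    by (intro path_expectation_mono) (auto simp: z_def)
  finally have *: "path_expectation n (z n) \<le> path_expectation N (y N)" .
  have "c * path_expectation n (\<lambda>w. of_bool (\<exists>j\<in>{N..n}. c \<le> y j w))
      = path_expectation n (\<lambda>w. c * of_bool (\<exists>j\<in>{N..n}. c \<le> y j w))"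
    by (simp add: path_expectation_def sum_distrib_left mult.left_commute)
  also have "\<dots> \<le> path_expectation n (z n)"
    using nonneg[OF \<open>N \<le> n\<close>] by (intro path_expectation_mono) (auto simp: z_def)
  also note *
  finally show ?thesis using \<open>0 < c\<close> by (simp add: field_simps)
qed

text \<open>
  Letting the time horizon and then the level tend to infinity in \<open>maximal_inequality\<close>. It
  reduces almost sure statements about the process to inequalities for a single attachment to a
  fixed tree.
\<close>
lemma AE_supermartingale_bounded:
  fixes y :: "nat \<Rightarrow> (nat \<Rightarrow> nat) \<Rightarrow> real"
  assumes past: "determined_by_past y"
    and nonneg: "\<And>n w. N \<le> n \<Longrightarrow> attachment_seq n w \<Longrightarrow> 0 \<le> y n w"
    and super: "\<And>n w. N \<le> n \<Longrightarrow> attachment_seq n w \<Longrightarrow>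
      (\<Sum>b\<in>{1..n}. attach_prob w n b * y (Suc n) (w(n := b))) \<le> y n w"
    and N: "2 \<le> N"
  shows "AE \<omega> in M. \<exists>C. \<forall>n\<ge>N. y n (\<lambda>i. W i \<omega>) \<le> C"
proof -
  define K where "K = path_expectation N (y N)"
  define G where "G = {\<omega> \<in> space M. \<forall>m. valid_upto m \<omega>}"
  define Q where "Q c n w \<longleftrightarrow> (\<exists>j\<in>{N..n}. c \<le> y j w)" for c :: real and n w
  define E where "E c n = {\<omega> \<in> space M. valid_upto n \<omega> \<and> Q c n (\<lambda>i. W i \<omega>)}" for c n
  have dQ: "determined_by_past (Q c)" for c
    unfolding determined_by_past_def Q_def
  proof (intro allI impI bex_cong refl)
    fix n j and w w' :: "nat \<Rightarrow> nat"
    assume "\<forall>i\<in>{2..<n}. w i = w' i" and j: "j \<in> {N..n}"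
    then have "y j w = y j w'"
      using past unfolding determined_by_past_def by (metis atLeastAtMost_iff atLeastLessThan_iff order.strict_trans2)
    then show "(c \<le> y j w) = (c \<le> y j w')" by simp
  qed
  have E: "E c n \<in> events" for c n
    unfolding E_def by (rule prob_eq_path_expectation(1)[OF dQ])
  have probE: "prob (E c n) \<le> K / c" if "N \<le> n" "0 < c" for c n
    unfolding E_def K_def prob_eq_path_expectation(2)[OF dQ] unfolding Q_def
    using that N by (intro maximal_inequality past nonneg super)
  have "{\<omega> \<in> space M. valid_upto m \<omega>} \<in> events" for m
    using prob_eq_path_expectation(1)[of "\<lambda>_ _. True" m] by (simp add: determined_by_past_def)
  then have G: "G \<in> events"
    unfolding G_def by (rule sets.sets_Collect_countable_All)
  define F where "F c = (\<Union>n. G \<inter> E c (N + n))" for c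
  have F: "F c \<in> events" for c
    unfolding F_def using E G by auto
  have probF: "prob (F c) \<le> K / c" if "0 < c" for c
  proof -
    have "incseq (\<lambda>n. G \<inter> E c (N + n))"
      by (rule incseq_SucI) (auto simp: E_def G_def Q_def)
    then have "(\<lambda>n. prob (G \<inter> E c (N + n))) \<longlonglongrightarrow> prob (F c)"
      unfolding F_def using E G by (intro finite_Lim_measure_incseq) auto
    moreover have "prob (G \<inter> E c (N + n)) \<le> K / c" for n
      using finite_measure_mono[of "G \<inter> E c (N + n)" "E c (N + n)"] E[of c "N + n"] probE[of "N + n" c] that
      by fastforce
    ultimately show ?thesis by (intro LIMSEQ_le_const2) auto
  qed
  \<comment> \<open>On \<open>B\<close> every level is reached at some time.\<close>
  define B where "B = (\<Inter>k. F (real (Suc k)))"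
  have B: "B \<in> events" unfolding B_def using F by auto
  have "(\<lambda>k. K / real (Suc k)) \<longlonglongrightarrow> 0"
    using tendsto_mult_right_zero[OF LIMSEQ_inverse_real_of_nat, of K] by (simp add: divide_inverse)
  moreover have "prob B \<le> K / real (Suc k)" for k
  proof -
    have "prob B \<le> prob (F (real (Suc k)))" using F by (intro finite_measure_mono) (auto simp: B_def)
    also have "\<dots> \<le> K / real (Suc k)" by (rule probF) simp
    finally show ?thesis .
  qed
  ultimately have "prob B \<le> 0" by (intro LIMSEQ_le_const) auto
  then have "AE \<omega> in M. \<omega> \<notin> B"
    using B measure_nonneg[of M B] by (intro AE_not_in) (auto simp: null_sets_def emeasure_eq_measure)
  with AE_valid AE_space show ?thesis
  proof eventually_elim
    case (elim \<omega>)
    then obtain k where "\<omega> \<notin> F (real (Suc k))" by (auto simp: B_def)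
    then have "\<not> Q (real (Suc k)) (N + n) (\<lambda>i. W i \<omega>)" for n
      using elim by (auto simp: F_def G_def E_def)
    then have "y n (\<lambda>i. W i \<omega>) \<le> real (Suc k)" if "N \<le> n" for n
      using that unfolding Q_def by (metis atLeastAtMost_iff le_add_diff_inverse linorder_linear order_refl)
    then show ?case by blast
  qed
qed

lemma AE_leaf_weight_growth:
  "AE \<omega> in M. \<exists>C. \<forall>n\<ge>7. real n powr (2 / 9) / leaf_weight (\<lambda>i. W i \<omega>) n \<le> C"
proof (rule AE_supermartingale_bounded)
  have "leaf_weight w n = leaf_weight w' n" if "\<forall>i\<in>{2..<n}. w i = w' i" for n w w'
    using friend_tree_cong'[OF that]
    by (simp add: leaf_weight_def leaf_count_def leaf_nbrs_def tree_degree_def)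
  then show "determined_by_past (\<lambda>n w. real n powr (2 / 9) / leaf_weight w n)"
    unfolding determined_by_past_def by metis
  show "0 \<le> real n powr (2 / 9) / leaf_weight w n" if "7 \<le> n" "attachment_seq n w" for n w
    using leaf_weight_ge_1[of n w] that by simp
  show "(\<Sum>b\<in>{1..n}. attach_prob w n b *
      (real (Suc n) powr (2 / 9) / leaf_weight (w(n := b)) (Suc n)))
      \<le> real n powr (2 / 9) / leaf_weight w n" if "7 \<le> n" "attachment_seq n w" for n w
    by (rule leaf_weight_inverse_step[OF that])
qed simp

section \<open>Every edge contains a hub\<close>

text \<open>
  As long as the two degrees of an edge \<open>u v\<close> have sum \<open>s\<close>, an attachment at \<open>u\<close> happens with
  probability at least \<open>1 / (s n)\<close>, namely by way of \<open>v\<close>. So no change occurs up to time \<open>n\<close> with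
  probability of order at most \<open>n powr (- 1 / s)\<close>, and \<open>n powr (1 / s)\<close> on this event is a
  supermartingale. Its boundedness excludes that the event persists.
\<close>
lemma AE_degree_sum_of_edge_changes:
  assumes N: "2 \<le> N" "u \<in> {1..N}"
  shows "AE \<omega> in M. \<not> (\<forall>n\<ge>N. v \<in> nbrs (\<lambda>i. W i \<omega>) n u \<and>
    tree_degree (\<lambda>i. W i \<omega>) n u + tree_degree (\<lambda>i. W i \<omega>) n v = s)"
proof -
  define A where "A n w \<longleftrightarrow> v \<in> nbrs w n u \<and> tree_degree w n u + tree_degree w n v = s" for n w
  define y where "y n w = (if \<forall>j\<in>{N..n}. A j w then real n powr (1 / real s) else 0)" for n w
  have A_cong: "A j w = A j w'" if "\<forall>i\<in>{2..<n}. w i = w' i" "j \<le> n" for j n w w'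
    using friend_tree_cong'[of j w w'] that by (simp add: A_def tree_degree_def)
  have past: "determined_by_past y"
    unfolding determined_by_past_def
  proof (intro allI impI)
    fix n and w w' :: "nat \<Rightarrow> nat"
    assume "\<forall>i\<in>{2..<n}. w i = w' i"
    then have "A j w = A j w'" if "j \<in> {N..n}" for j
      using A_cong[of n w w' j] that by simp
    then show "y n w = y n w'" by (simp add: y_def)
  qed
  have "AE \<omega> in M. \<exists>C. \<forall>n\<ge>N. y n (\<lambda>i. W i \<omega>) \<le> C"
  proof (rule AE_supermartingale_bounded[OF past _ _ N(1)])
    show "0 \<le> y n w" for n w by (simp add: y_def)
    fix n w assume n: "N \<le> n" and a: "attachment_seq n w"
    then have n2: "2 \<le> n" and u: "u \<in> {1..n}" using N by auto
    have A_upd: "A j (w(n := b)) = A j w" if "j \<le> n" for j b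
      by (rule A_cong[of j]) (use that in auto)
    show "(\<Sum>b\<in>{1..n}. attach_prob w n b * y (Suc n) (w(n := b))) \<le> y n w"
    proof (cases "\<forall>j\<in>{N..n}. A j w")
      case False
      then obtain j where "j \<in> {N..n}" "\<not> A j w" by blast
      then have "y (Suc n) (w(n := b)) = 0" for b
        using A_upd[of j b] by (auto simp: y_def intro!: bexI[of _ j])
      then show ?thesis by (simp add: y_def)
    next
      case True
      then have An: "A n w" using n by auto
      then have v: "v \<in> nbrs w n u" and s: "tree_degree w n u + tree_degree w n v = s" by (auto simp: A_def)
      have vn: "v \<in> {1..n}" and uv: "u \<noteq> v" using v nbrs_subset[OF n2 a, of u] by auto
      have D: "1 \<le> tree_degree w n u" "1 \<le> tree_degree w n v"
        using degree_pos[OF n2 a] u vn by auto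
      have s2: "2 \<le> s" using s D by simp
      have "1 / real s \<le> 1 / real (tree_degree w n v)"
        using s D by (intro divide_left_mono) auto
      also have "\<dots> \<le> (\<Sum>a\<in>nbrs w n u. 1 / real (tree_degree w n a))"
        using v finite_nbrs[OF n2 a] by (intro member_le_sum) auto
      finally have p: "1 / real s / n \<le> attach_prob w n u"
        unfolding attach_prob_def by (rule divide_right_mono) simp
      let ?c = "(real n + 1) powr (1 / real s)"
      have y': "y (Suc n) (w(n := b)) \<le> (if b = u then 0 else ?c)" if b: "b \<in> {1..n}" for b
      proof (cases "b = u")
        case True
        then have "\<not> A (Suc n) (w(n := b))"
          unfolding A_def degree_step[OF n2 a b] using s u uv vn by auto
        then show ?thesis using True n by (auto simp: y_def)
      next
        case False
        then show ?thesis by (simp add: y_def add.commute)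
      qed
      have "(\<Sum>b\<in>{1..n}. attach_prob w n b * y (Suc n) (w(n := b)))
          \<le> (\<Sum>b\<in>{1..n}. attach_prob w n b * (if b = u then 0 else ?c))"
        by (intro sum_mono mult_left_mono attach_prob_nonneg y')
      also have "\<dots> = (\<Sum>b\<in>{1..n}. attach_prob w n b * ?c - (if b = u then attach_prob w n u * ?c else 0))"
        by (intro sum.cong refl) auto
      also have "\<dots> = (\<Sum>b\<in>{1..n}. attach_prob w n b) * ?c - attach_prob w n u * ?c"
        using u by (simp only: sum_subtractf sum_distrib_right sum.delta finite_atLeastAtMost if_True)
      also have "\<dots> = ?c * (1 - attach_prob w n u)"
        by (simp only: sum_attach_prob[OF n2 a]) (simp add: algebra_simps)
      also have "\<dots> \<le> ?c * (1 - 1 / real s / n)"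
        using p by (intro mult_left_mono) auto
      also have "\<dots> \<le> real n powr (1 / real s)"
        using n2 by (intro powr_step_le) auto
      also have "\<dots> = y n w" using True by (simp add: y_def)
      finally show ?thesis .
    qed
  qed
  with AE_attachment_seq show ?thesis
  proof eventually_elim
    case (elim \<omega>)
    let ?w = "\<lambda>i. W i \<omega>"
    obtain C where C: "\<And>n. N \<le> n \<Longrightarrow> y n ?w \<le> C" using elim by blast
    show ?case
    proof
      assume "\<forall>n\<ge>N. v \<in> nbrs ?w n u \<and> tree_degree ?w n u + tree_degree ?w n v = s"
      then have A: "A n ?w" if "N \<le> n" for n using that by (simp add: A_def)
      have "tree_degree ?w N u \<le> s" using A[of N] by (simp add: A_def)
      then have "1 \<le> s" using degree_pos[OF N(1) _ N(2)] elim(1) by (meson le_trans)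
      then have "filterlim (\<lambda>n. real n powr (1 / real s)) at_top sequentially"
        by real_asymp
      then have "eventually (\<lambda>n. C < real n powr (1 / real s)) sequentially"
        by (rule filterlim_at_top_dense[THEN iffD1, rule_format])
      then obtain n where n: "N \<le> n" "C < real n powr (1 / real s)"
        using eventually_conj[OF eventually_ge_at_top[of N]] eventually_happens'[OF sequentially_bot] by blast
      then have "y n ?w = real n powr (1 / real s)" using A by (simp add: y_def)
      then show False using C[OF n(1)] n(2) by simp
    qed
  qed
qed

text \<open>
  The number \<open>B = D - L\<close> grows when a leaf next to \<open>u\<close> is attached to, which is at least \<open>D\<close> times
  rarer than an attachment at \<open>u\<close>. Since \<open>D\<close> grows by one in the latter case, \<open>B\<close> should be at most
  of order \<open>ln D\<close>; the
  cruder order \<open>sqrt D\<close> suffices and has a simple supermartingale. It needs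
  \<open>(B + 4) * (1 / sqrt D - 1 / sqrt (D + 1)) \<ge> 1 / (D * sqrt D)\<close>, which the summand \<open>4\<close> guarantees
  already for \<open>B = 0\<close> and \<open>D = 1\<close>.
\<close>
lemma AE_nonleaf_nbrs_bound:
  assumes N: "2 \<le> N" "u \<in> {1..N}"
  shows "AE \<omega> in M. \<exists>C. \<forall>n\<ge>N.
    (real (tree_degree (\<lambda>i. W i \<omega>) n u) - real (leaf_count (\<lambda>i. W i \<omega>) n u) + 4)
      / sqrt (real (tree_degree (\<lambda>i. W i \<omega>) n u)) \<le> C"
proof -
  define g :: "nat \<Rightarrow> nat \<Rightarrow> real" where "g D L = (real D - real L + 4) / sqrt (real D)" for D L
  have "AE \<omega> in M. \<exists>C. \<forall>n\<ge>N. g (tree_degree (\<lambda>i. W i \<omega>) n u) (leaf_count (\<lambda>i. W i \<omega>) n u) \<le> C"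
  proof (rule AE_supermartingale_bounded[OF _ _ _ N(1)])
    show "determined_by_past (\<lambda>n w. g (tree_degree w n u) (leaf_count w n u))"
      unfolding determined_by_past_def leaf_count_def leaf_nbrs_def tree_degree_def
      by (intro allI impI) (drule friend_tree_cong', simp)
    fix n w assume n: "N \<le> n" and a: "attachment_seq n w"
    then have n2: "2 \<le> n" and u: "u \<in> {1..n}" using N by auto
    define D L where "D = tree_degree w n u" and "L = leaf_count w n u"
    have LD: "L \<le> D" using leaf_count_le_degree[OF n2 a] by (simp add: D_def L_def)
    show "0 \<le> g (tree_degree w n u) (leaf_count w n u)"
      using leaf_count_le_degree[OF n2 a, of u] by (simp add: g_def)
    have D: "1 \<le> D" unfolding D_def by (rule degree_pos[OF n2 a u])
    define x d where "x = real D - real L + 4" and "d = real D"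
    have x: "4 \<le> x" and d: "1 \<le> d" using LD D by (auto simp: x_def d_def)
    define q r where "q = sqrt d" and "r = sqrt (d + 1)"
    have qr: "1 \<le> q" "q \<le> r" "q * q = d" "r * r = d + 1"
      using d by (auto simp: q_def r_def)
    have up: "g (Suc D) (Suc L) - g D L = - (x * (r - q) / (q * r))"
      using qr by (simp add: g_def x_def d_def q_def r_def field_simps)
    have "0 \<le> x * (r - q) / (q * r)" using x qr by auto
    then have mono: "g (Suc D) (Suc L) \<le> g D L" using up by linarith
    have "1 / (d * q) \<le> x * (r - q) / (q * r)"
    proof -
      have "r * q \<le> r * r" using qr by (intro mult_left_mono) auto
      then have "r * (r + q) \<le> 2 * (r * r)" unfolding distrib_left by linarith
      also have "\<dots> \<le> 4 * d" using qr d by simp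
      finally have "r * (r + q) \<le> 4 * d" .
      moreover have "(r - q) * (r + q) = 1" using qr by (simp add: algebra_simps)
      then have "r - q = 1 / (r + q)" using qr by (simp add: field_simps)
      ultimately have "4 / (4 * d) \<le> 4 * (r - q) / r"
        using divide_left_mono[of "r * (r + q)" "4 * d" 4] qr d by (simp add: mult.commute)
      then have "1 / d \<le> 4 * (r - q) / r" by simp
      also have "\<dots> \<le> x * (r - q) / r" using x qr by (intro divide_right_mono mult_right_mono) auto
      finally have "1 / d / q \<le> x * (r - q) / r / q" using qr by (intro divide_right_mono) auto
      then show ?thesis by (simp add: mult.commute)
    qed
    then have "g (Suc D) (Suc L) - g D L \<le> - (1 / (d * q))" using up by simp
    moreover have "g D (L - 1) - g D L \<le> 1 / q"
      using qr by (cases L) (simp_all add: g_def q_def d_def diff_divide_distrib[symmetric] divide_right_mono)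
    ultimately have "L / n * (g (Suc D) (Suc L) - g D L) + L / (real D * real n) * (g D (L - 1) - g D L)
        \<le> L / n * (- (1 / (d * q))) + L / (real D * real n) * (1 / q)"
      by (intro add_mono mult_left_mono) auto
    also have "\<dots> = 0" by (simp add: d_def)
    finally have "g D L + L / n * (g (Suc D) (Suc L) - g D L) + L / (real D * real n) * (g D (L - 1) - g D L) \<le> g D L"
      by simp
    with vertex_step_expectation[OF n2 a u D_def L_def, of g, OF mono]
    show "(\<Sum>b\<in>{1..n}. attach_prob w n b *
        g (tree_degree (w(n := b)) (Suc n) u) (leaf_count (w(n := b)) (Suc n) u))
      \<le> g (tree_degree w n u) (leaf_count w n u)"
      unfolding D_def[symmetric] L_def[symmetric] by (rule order_trans)
  qed
  then show ?thesis by (simp add: g_def)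
qed

text \<open>
  For a pure birth chain with birth probability \<open>L / n\<close>, the process \<open>(n - 1) / (L - 1)\<close> is a
  martingale. Here \<open>L\<close> can also decrease, with probability at most \<open>1 / n\<close>. Replacing \<open>L - 1\<close> by
  \<open>L - 3\<close> absorbs this as soon as \<open>(L - 3) * (L - 2) \<le> L * (L - 4)\<close>, that is \<open>L \<ge> 6\<close>.
\<close>
lemma AE_leaf_count_linear:
  assumes N: "2 \<le> N" "u \<in> {1..N}"
  shows "AE \<omega> in M. (\<forall>n\<ge>N. 6 \<le> leaf_count (\<lambda>i. W i \<omega>) n u) \<longrightarrow>
    (\<exists>C. \<forall>n\<ge>N. (real n - 1) / (real (leaf_count (\<lambda>i. W i \<omega>) n u) - 3) \<le> C)"
proof -
  define A where "A n w \<longleftrightarrow> 6 \<le> leaf_count w n u" for n w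
  define y where "y n w = (if \<forall>j\<in>{N..n}. A j w then (real n - 1) / (real (leaf_count w n u) - 3) else 0)" for n w
  have L_cong: "leaf_count w n u = leaf_count w' n u" if "\<forall>i\<in>{2..<n}. w i = w' i" for n w w'
    using friend_tree_cong'[OF that] by (simp add: leaf_count_def leaf_nbrs_def tree_degree_def)
  have A_cong: "A j w = A j w'" if "\<forall>i\<in>{2..<n}. w i = w' i" "j \<le> n" for j n w w'
    using L_cong[of j w w'] that by (simp add: A_def)
  have past: "determined_by_past y"
    unfolding determined_by_past_def
  proof (intro allI impI)
    fix n and w w' :: "nat \<Rightarrow> nat"
    assume *: "\<forall>i\<in>{2..<n}. w i = w' i"
    then have "A j w = A j w'" if "j \<in> {N..n}" for j
      using A_cong[of n w w' j] that by simp
    then show "y n w = y n w'" using L_cong[OF *] by (simp add: y_def)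
  qed
  have "AE \<omega> in M. \<exists>C. \<forall>n\<ge>N. y n (\<lambda>i. W i \<omega>) \<le> C"
  proof (rule AE_supermartingale_bounded[OF past _ _ N(1)])
    show "0 \<le> y n w" if "N \<le> n" for n w
      using that N by (auto simp: y_def A_def dest!: bspec[of _ _ n])
    fix n w assume n: "N \<le> n" and a: "attachment_seq n w"
    then have n2: "2 \<le> n" and u: "u \<in> {1..n}" using N by auto
    have A_upd: "A j (w(n := b)) = A j w" if "j \<le> n" for j b
      by (rule A_cong[of j]) (use that in auto)
    show "(\<Sum>b\<in>{1..n}. attach_prob w n b * y (Suc n) (w(n := b))) \<le> y n w"
    proof (cases "\<forall>j\<in>{N..n}. A j w")
      case False
      then obtain j where "j \<in> {N..n}" "\<not> A j w" by blast
      then have "y (Suc n) (w(n := b)) = 0" for b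
        using A_upd[of j b] by (auto simp: y_def intro!: bexI[of _ j])
      moreover have "y n w = 0" using False by (auto simp: y_def)
      ultimately show ?thesis by simp
    next
      case True
      define D L where "D = tree_degree w n u" and "L = leaf_count w n u"
      have L6: "6 \<le> L" using True n by (auto simp: A_def L_def)
      have LD: "L \<le> D" using leaf_count_le_degree[OF n2 a] by (simp add: D_def L_def)
      \<comment> \<open>Dropping the indicator from \<open>y\<close> is harmless: after one step \<open>L \<ge> 5\<close>, so \<open>g\<close> is still positive.\<close>
      define g :: "nat \<Rightarrow> nat \<Rightarrow> real" where "g = (\<lambda>D L. real n / (real L - 3))"
      define l where "l = real L"
      have l: "6 \<le> l" using L6 by (simp add: l_def)
      have gs: "g (Suc D) (Suc L) = n / (l - 2)" "g D (L - 1) = n / (l - 4)" "g D L = n / (l - 3)"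
        using L6 by (simp_all add: g_def l_def of_nat_diff)
      have mono: "g (Suc D) (Suc L) \<le> g D L"
        unfolding gs using l by (intro divide_left_mono) auto
      have y': "y (Suc n) (w(n := b)) \<le> g (tree_degree (w(n := b)) (Suc n) u) (leaf_count (w(n := b)) (Suc n) u)"
        if b: "b \<in> {1..n}" for b
      proof -
        have "5 \<le> leaf_count (w(n := b)) (Suc n) u"
          using L6 unfolding leaf_count_step[OF n2 a b u] L_def by auto
        then show ?thesis by (auto simp: y_def g_def)
      qed
      have "(\<Sum>b\<in>{1..n}. attach_prob w n b * y (Suc n) (w(n := b)))
        \<le> (\<Sum>b\<in>{1..n}. attach_prob w n b *
             g (tree_degree (w(n := b)) (Suc n) u) (leaf_count (w(n := b)) (Suc n) u))"
        by (intro sum_mono mult_left_mono attach_prob_nonneg y')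
      also have "\<dots> \<le> g D L + L / n * (g (Suc D) (Suc L) - g D L) + L / (real D * real n) * (g D (L - 1) - g D L)"
        by (rule vertex_step_expectation[OF n2 a u D_def L_def, of g, OF mono])
      also have "L / (real D * real n) * (g D (L - 1) - g D L) \<le> 1 / n * (g D (L - 1) - g D L)"
      proof (rule mult_right_mono)
        show "real L / (real D * real n) \<le> 1 / real n"
          using LD L6 n2 by (simp add: field_simps)
        show "0 \<le> g D (L - 1) - g D L"
          unfolding gs using l by (simp add: divide_left_mono)
      qed
      also have "g D L + L / n * (g (Suc D) (Suc L) - g D L) + 1 / n * (g D (L - 1) - g D L)
          = n / (l - 3) + l / (l - 2) - l / (l - 3) + 1 / (l - 4) - 1 / (l - 3)"
        unfolding gs l_def[symmetric] using n2 l by (simp add: right_diff_distrib)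
      also have "\<dots> \<le> (real n - 1) / (l - 3)"
      proof -
        have "1 / (l - 4) \<le> l / ((l - 3) * (l - 2))"
        proof -
          have "(l - 3) * (l - 2) \<le> l * (l - 4)" using l by (simp add: algebra_simps)
          then have "(l - 3) * (l - 2) / ((l - 4) * ((l - 3) * (l - 2)))
              \<le> l * (l - 4) / ((l - 4) * ((l - 3) * (l - 2)))"
            using l by (intro divide_right_mono) auto
          then show ?thesis using l by simp
        qed
        also have "\<dots> = l / (l - 3) - l / (l - 2)" using l by (simp add: field_simps)
        finally show ?thesis by (simp add: diff_divide_distrib)
      qed
      also have "\<dots> = y n w" using True by (simp add: y_def l_def L_def)
      finally show ?thesis by simp
    qed
  qed
  then show ?thesis
  proof eventually_elim
    case (elim \<omega>)
    then obtain C where C: "\<And>n. N \<le> n \<Longrightarrow> y n (\<lambda>i. W i \<omega>) \<le> C" by blast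
    show ?case
    proof (intro impI exI allI)
      fix n assume "\<forall>n\<ge>N. 6 \<le> leaf_count (\<lambda>i. W i \<omega>) n u" and n: "N \<le> n"
      then show "(real n - 1) / (real (leaf_count (\<lambda>i. W i \<omega>) n u) - 3) \<le> C"
        using C[OF n] by (simp add: y_def A_def)
    qed
  qed
qed

end

lemma degree_mono:
  assumes "\<And>n. attachment_seq n w" "2 \<le> m" "m \<le> n"
  shows "tree_degree w m v \<le> tree_degree w n v"
  using assms(3)
proof (induction n rule: dec_induct)
  case (step n)
  then show ?case using degree_mono_Suc[of n w v] assms by simp
qed simp

text \<open>
  If \<open>D\<close> is unbounded, then \<open>D - L \<le> C * sqrt D\<close> forces \<open>L \<ge> 6\<close> from some time on; from then on
  the linear bound on \<open>L\<close> applies, and \<open>D \<ge> L\<close>.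
\<close>
lemma liminf_degree_pos:
  assumes w: "\<And>n. attachment_seq n w"
    and bound: "\<And>N. 2 \<le> N \<Longrightarrow> u \<le> N \<Longrightarrow>
      \<exists>C. \<forall>n\<ge>N. (real (tree_degree w n u) - real (leaf_count w n u) + 4) / sqrt (real (tree_degree w n u)) \<le> C"
    and linear: "\<And>N. 2 \<le> N \<Longrightarrow> u \<le> N \<Longrightarrow> \<forall>n\<ge>N. 6 \<le> leaf_count w n u \<Longrightarrow>
      \<exists>C. \<forall>n\<ge>N. (real n - 1) / (real (leaf_count w n u) - 3) \<le> C"
    and unbounded: "\<And>d. \<exists>n\<ge>2. d \<le> tree_degree w n u"
  shows "0 < liminf_degree w u"
proof -
  define N0 where "N0 = max 2 u"
  obtain C where C: "\<And>n. N0 \<le> n \<Longrightarrow>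
      (real (tree_degree w n u) - real (leaf_count w n u) + 4) / sqrt (real (tree_degree w n u)) \<le> C"
    using bound[of N0] by (auto simp: N0_def)
  obtain k :: nat where k: "C + 6 \<le> real k" by (metis real_arch_simple)
  \<comment> \<open>For \<open>D \<ge> d\<close> the bound gives \<open>L \<ge> (sqrt D - C) * sqrt D + 4 \<ge> 6 * sqrt D + 4\<close>.\<close>
  define d where "d = (k + 6)\<^sup>2"
  obtain N1 where N1: "2 \<le> N1" "d \<le> tree_degree w N1 u" using unbounded by blast
  define N where "N = max N0 N1"
  have N: "2 \<le> N" "u \<le> N" by (auto simp: N_def N0_def)
  have "6 \<le> leaf_count w n u" if n: "N \<le> n" for n
  proof -
    define D L where "D = real (tree_degree w n u)" and "L = real (leaf_count w n u)"
    have "d \<le> tree_degree w n u"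
      using N1 n degree_mono[OF w N1(1), of n u] by (simp add: N_def)
    then have "real d \<le> D" by (simp add: D_def)
    then have "(real k + 6)\<^sup>2 \<le> D" by (simp add: d_def)
    then have sq: "real k + 6 \<le> sqrt D" by (rule real_le_rsqrt)
    have "(D - L + 4) / sqrt D \<le> C" using C[of n] n by (simp add: D_def L_def N_def)
    moreover have "0 < sqrt D" using sq by linarith
    ultimately have "D - L + 4 \<le> C * sqrt D" by (simp only: pos_divide_le_eq)
    moreover have "sqrt D * sqrt D = D" by (simp add: D_def)
    moreover have "6 * sqrt D \<le> (sqrt D - C) * sqrt D"
      using sq k by (intro mult_right_mono) (auto simp: D_def)
    ultimately have "6 * sqrt D + 4 \<le> L" by (simp add: algebra_simps)
    then have "6 \<le> L" using sq by linarith
    then show ?thesis by (simp add: L_def)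
  qed
  then have L6: "\<forall>n\<ge>N. 6 \<le> leaf_count w n u" by blast
  obtain C' where C': "\<And>n. N \<le> n \<Longrightarrow> (real n - 1) / (real (leaf_count w n u) - 3) \<le> C'"
    using linear[OF N L6] by blast
  define c where "c = max C' 1"
  have "ereal (1 / (2 * c)) \<le> ereal (real (tree_degree w n u) / real n)" if n: "N \<le> n" for n
  proof -
    have L: "6 \<le> leaf_count w n u" using L6 n by blast
    have n2: "2 \<le> n" using n N by simp
    have "(real n - 1) / (real (leaf_count w n u) - 3) \<le> c" using C'[OF n] by (simp add: c_def)
    then have "real n - 1 \<le> c * (real (leaf_count w n u) - 3)"
      using L by (simp add: divide_le_eq)
    also have "\<dots> \<le> c * real (tree_degree w n u)"
      using leaf_count_le_degree[OF n2 w, of u] by (intro mult_left_mono) (auto simp: c_def)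
    finally have "real n / 2 \<le> c * real (tree_degree w n u)" using n2 by simp
    then have "1 / (2 * c) \<le> real (tree_degree w n u) / real n"
      using n2 by (simp add: c_def field_simps)
    then show ?thesis by simp
  qed
  then have "eventually (\<lambda>n. ereal (1 / (2 * c)) \<le> ereal (real (tree_degree w n u) / real n)) sequentially"
    using eventually_ge_at_top[of N] by (rule eventually_mono[rotated])
  then have "ereal (1 / (2 * c)) \<le> liminf_degree w u"
    unfolding liminf_degree_def by (rule Liminf_bounded)
  moreover have "0 < 1 / (2 * c)" by (simp add: c_def)
  ultimately show ?thesis by (metis ereal_less(2) less_le_trans)
qed

text \<open>
  The sum of the two degrees is nondecreasing, so if it were bounded it would eventually be constant.
\<close>
lemma edge_degree_unbounded:
  assumes w: "\<And>n. attachment_seq n w" and uv: "v \<in> nbrs w m u" "2 \<le> m"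
    and change: "\<And>N s. 2 \<le> N \<Longrightarrow> u \<in> {1..N} \<Longrightarrow>
      \<not> (\<forall>n\<ge>N. v \<in> nbrs w n u \<and> tree_degree w n u + tree_degree w n v = s)"
  shows "(\<forall>d. \<exists>n\<ge>2. d \<le> tree_degree w n u) \<or> (\<forall>d. \<exists>n\<ge>2. d \<le> tree_degree w n v)"
proof (rule ccontr)
  assume "\<not> ?thesis"
  then obtain d e where de: "\<And>n. 2 \<le> n \<Longrightarrow> tree_degree w n u < d" "\<And>n. 2 \<le> n \<Longrightarrow> tree_degree w n v < e"
    by (meson not_le)
  define f where "f n = tree_degree w n u + tree_degree w n v" for n
  let ?F = "f ` {m..}"
  have "?F \<subseteq> {..d + e}" using de uv(2) by (fastforce simp: f_def intro: add_mono less_imp_le)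
  then have fin: "finite ?F" by (rule finite_subset) simp
  obtain N where N: "m \<le> N" "f N = Max ?F"
    using Max_in[OF fin] by auto
  have const: "f n = f N" if "N \<le> n" for n
  proof (rule antisym)
    show "f n \<le> f N" unfolding N(2) using N(1) that fin by (intro Max_ge) auto
    show "f N \<le> f n" unfolding f_def using N(1) that uv(2) by (intro add_mono degree_mono[OF w]) auto
  qed
  have edge: "v \<in> nbrs w n u" if "N \<le> n" for n
    using nbrs_mono[of m n w u] uv N(1) that by auto
  have u: "u \<in> {1..N}"
  proof -
    have "u \<in> {1..m}" using uv nbrs_outside[OF uv(2) w, of u] by blast
    then show ?thesis using N(1) by simp
  qed
  have "2 \<le> N" using N(1) uv(2) by simp
  moreover have "\<forall>n\<ge>N. v \<in> nbrs w n u \<and> tree_degree w n u + tree_degree w n v = f N"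
  proof (intro allI impI conjI)
    fix n assume n: "N \<le> n"
    show "v \<in> nbrs w n u" by (rule edge[OF n])
    show "tree_degree w n u + tree_degree w n v = f N"
      unfolding const[OF n, symmetric] by (simp only: f_def)
  qed
  ultimately show False using change[OF _ u] by blast
qed

lemma (in random_friend_tree) AE_every_edge_contains_hub:
  "AE \<omega> in M. \<forall>n\<ge>2. \<forall>u. \<forall>v\<in>nbrs (\<lambda>i. W i \<omega>) n u.
    0 < liminf_degree (\<lambda>i. W i \<omega>) u \<or> 0 < liminf_degree (\<lambda>i. W i \<omega>) v"
proof -
  have 1: "AE \<omega> in M. \<forall>N u v s. 2 \<le> N \<longrightarrow> u \<in> {1..N} \<longrightarrow>
      \<not> (\<forall>n\<ge>N. v \<in> nbrs (\<lambda>i. W i \<omega>) n u \<and>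
        tree_degree (\<lambda>i. W i \<omega>) n u + tree_degree (\<lambda>i. W i \<omega>) n v = s)"
    unfolding AE_all_countable by (intro allI AE_impI AE_degree_sum_of_edge_changes)
  have 2: "AE \<omega> in M. \<forall>N u. 2 \<le> N \<longrightarrow> u \<in> {1..N} \<longrightarrow> (\<exists>C. \<forall>n\<ge>N.
    (real (tree_degree (\<lambda>i. W i \<omega>) n u) - real (leaf_count (\<lambda>i. W i \<omega>) n u) + 4)
      / sqrt (real (tree_degree (\<lambda>i. W i \<omega>) n u)) \<le> C)"
    unfolding AE_all_countable by (intro allI AE_impI AE_nonleaf_nbrs_bound)
  have 3: "AE \<omega> in M. \<forall>N u. 2 \<le> N \<longrightarrow> u \<in> {1..N} \<longrightarrow>
    (\<forall>n\<ge>N. 6 \<le> leaf_count (\<lambda>i. W i \<omega>) n u) \<longrightarrow>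
    (\<exists>C. \<forall>n\<ge>N. (real n - 1) / (real (leaf_count (\<lambda>i. W i \<omega>) n u) - 3) \<le> C)"
    unfolding AE_all_countable by (intro allI AE_impI AE_leaf_count_linear)
  from AE_attachment_seq 1 2 3 show ?thesis
  proof eventually_elim
    case (elim \<omega>)
    let ?w = "\<lambda>i. W i \<omega>"
    have w: "attachment_seq n ?w" for n using elim(1) by blast
    have pos: "0 < liminf_degree ?w x" if "1 \<le> x" "\<forall>d. \<exists>n\<ge>2. d \<le> tree_degree ?w n x" for x
    proof (rule liminf_degree_pos[OF w])
      fix N assume N: "2 \<le> N" "x \<le> N"
      then have x: "x \<in> {1..N}" using that by simp
      show "\<exists>C. \<forall>n\<ge>N. (real (tree_degree ?w n x) - real (leaf_count ?w n x) + 4) / sqrt (real (tree_degree ?w n x)) \<le> C"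
        using elim(3)[rule_format, OF N(1) x] .
      show "\<exists>C. \<forall>n\<ge>N. (real n - 1) / (real (leaf_count ?w n x) - 3) \<le> C"
        if "\<forall>n\<ge>N. 6 \<le> leaf_count ?w n x"
        using elim(4)[rule_format, OF N(1) x] that by blast
    next
      fix d show "\<exists>n\<ge>2. d \<le> tree_degree ?w n x" using that(2) by blast
    qed
    show ?case
    proof (intro allI impI ballI)
      fix m u v assume m: "2 \<le> m" and v: "v \<in> nbrs ?w m u"
      have "v \<in> {1..m}" using nbrs_subset[OF m w, of u] v by blast
      moreover have "u \<in> {1..m}" using nbrs_outside[OF m w, of u] v by blast
      moreover have "(\<forall>d. \<exists>n\<ge>2. d \<le> tree_degree ?w n u) \<or> (\<forall>d. \<exists>n\<ge>2. d \<le> tree_degree ?w n v)"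
        by (rule edge_degree_unbounded[OF w v m]) (use elim(2) in blast)
      ultimately show "0 < liminf_degree ?w u \<or> 0 < liminf_degree ?w v"
        using pos[of u] pos[of v] by auto
    qed
  qed
qed

section \<open>Counting the hubs\<close>

text \<open>
  Let \<open>H\<close> meet every edge. A nonleaf outside \<open>H\<close> has a child, the child lies in \<open>H\<close>, and the nonleaf
  can be recovered from it as its parent.
\<close>
lemma card_nonleaves_le_cover:
  assumes n: "2 \<le> n" and a: "attachment_seq n w"
    and cover: "\<And>u v. v \<in> nbrs w n u \<Longrightarrow> u \<in> H \<or> v \<in> H"
  shows "card {v \<in> {1..n}. 2 \<le> tree_degree w n v} \<le> 2 * card (H \<inter> {1..n})"
proof -
  let ?H = "H \<inter> {1..n}"
  have "{v \<in> {1..n}. 2 \<le> tree_degree w n v} \<subseteq> ?H \<union> (\<lambda>k. w (k - 1)) ` ?H"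
  proof
    fix v assume v: "v \<in> {v \<in> {1..n}. 2 \<le> tree_degree w n v}"
    then obtain k where k: "k \<in> {3..n}" "w (k - 1) = v" using nonleaf_has_child[OF n a] by blast
    then have "k \<in> nbrs w n v" using child_edge[of k n w] by auto
    then have "v \<in> H \<or> k \<in> H" by (rule cover)
    then show "v \<in> ?H \<union> (\<lambda>k. w (k - 1)) ` ?H" using v k by force
  qed
  then have "card {v \<in> {1..n}. 2 \<le> tree_degree w n v} \<le> card (?H \<union> (\<lambda>k. w (k - 1)) ` ?H)"
    by (intro card_mono) auto
  also have "\<dots> \<le> card ?H + card ((\<lambda>k. w (k - 1)) ` ?H)" by (rule card_Un_le)
  also have "\<dots> \<le> 2 * card ?H" using card_image_le[of ?H "\<lambda>k. w (k - 1)"] by simp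
  finally show ?thesis .
qed
text \<open>
  The difference between \<open>2 / 9\<close> and \<open>1 / 5\<close> is \<open>1 / 45\<close>, which makes the quotient diverge in spite of
  the unknown constant.
\<close>
lemma (in random_friend_tree) AE_number_of_hubs:
  "AE \<omega> in M. filterlim
     (\<lambda>n. real (card {u \<in> {1..n}. liminf_degree (\<lambda>i. W i \<omega>) u > 0}) / real n powr (1 / 5))
     at_top sequentially"
  using AE_attachment_seq AE_every_edge_contains_hub AE_leaf_weight_growth
proof eventually_elim
  case (elim \<omega>)
  let ?w = "\<lambda>i. W i \<omega>"
  have w: "attachment_seq n ?w" for n using elim(1) by blast
  obtain C where C: "\<And>n. 7 \<le> n \<Longrightarrow> real n powr (2 / 9) / leaf_weight ?w n \<le> C" using elim(3) by blast
  define c where "c = max C 1"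
  have c: "0 < c" by (simp add: c_def)
  let ?H = "\<lambda>n. {u \<in> {1..n}. liminf_degree ?w u > 0}"
  have "real n powr (1 / 45) / (2 * c) \<le> real (card (?H n)) / real n powr (1 / 5)" if n: "7 \<le> n" for n
  proof -
    have S: "1 \<le> leaf_weight ?w n" using n by (intro leaf_weight_ge_1 w) simp
    have "real n powr (2 / 9) / leaf_weight ?w n \<le> c" using C[OF n] by (simp add: c_def)
    then have "real n powr (2 / 9) \<le> c * leaf_weight ?w n" using S by (simp add: divide_le_eq)
    also have "leaf_weight ?w n \<le> card {v \<in> {1..n}. 2 \<le> tree_degree ?w n v}"
      using n by (intro leaf_weight_le_card_nonleaves w) simp
    also have "card {v \<in> {1..n}. 2 \<le> tree_degree ?w n v} \<le> 2 * card ({u. 0 < liminf_degree ?w u} \<inter> {1..n})"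
    proof (intro card_nonleaves_le_cover w)
      show n2: "2 \<le> n" using n by simp
      fix u v assume "v \<in> nbrs ?w n u"
      from bspec[OF spec[OF mp[OF spec[OF elim(2)] n2]] this]
      show "u \<in> {u. 0 < liminf_degree ?w u} \<or> v \<in> {u. 0 < liminf_degree ?w u}" by simp
    qed
    also have "{u. 0 < liminf_degree ?w u} \<inter> {1..n} = ?H n" by auto
    finally have "real n powr (2 / 9) \<le> c * real (2 * card (?H n))" using c by simp
    then have "real n powr (2 / 9) / (2 * c) \<le> real (card (?H n))" using c by (simp add: field_simps)
    then have "real n powr (2 / 9) / (2 * c) / real n powr (1 / 5) \<le> real (card (?H n)) / real n powr (1 / 5)"
      by (rule divide_right_mono) simp
    moreover have "real n powr (2 / 9) = real n powr (1 / 45) * real n powr (1 / 5)"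
      by (simp flip: powr_add)
    ultimately show ?thesis using n by simp
  qed
  then have ev: "eventually (\<lambda>n. real n powr (1 / 45) / (2 * c) \<le> real (card (?H n)) / real n powr (1 / 5)) sequentially"
    using eventually_ge_at_top[of 7] by (rule eventually_mono[rotated])
  have "filterlim (\<lambda>n. real n powr (1 / 45) / (2 * c)) at_top sequentially"
    using c by real_asymp
  then show ?case using ev by (rule filterlim_at_top_mono)
qed

theorem theorem4p5:
  shows "\<exists>\<delta>::real. \<delta> > 1 / 10 \<and>
    (\<forall>(M :: 'w measure) (V :: nat \<Rightarrow> 'w \<Rightarrow> nat) (W :: nat \<Rightarrow> 'w \<Rightarrow> nat).
      random_friend_tree M V W \<longrightarrow>
      (AE \<omega> in M.
        filterlim
          (\<lambda>n. real (card {u \<in> {1..n}. liminf_degree (\<lambda>i. W i \<omega>) u > 0}) / real n powr \<delta>)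
          at_top sequentially))"
  using random_friend_tree.AE_number_of_hubs by (intro exI[of _ "1 / 5"]) auto

end
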